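(* Let $\beta\in(0,1)$ and $\sigma>0$ be fixed, and let $d=d_\varepsilon\to\infty$ and $k=k_\varepsilon\to\infty$ as $\varepsilon\to0$ be such that $k=o(d)$, $\log\log d=o(k)$ and $\log\binom dk=o(\log\varepsilon^{-1})$ as $\varepsilon\to0$. Let $r_{\varepsilon,k}>0$ satisfy $$\liminf_{\varepsilon\to0}\frac{a_{\varepsilon,k}(r_{\varepsilon,k})}{\sqrt{\log\binom dk}}>\sqrt2\,\bigl(1+\sqrt{1-\beta}\bigr).$$ Then the selector $\hat{\boldsymbol\eta}=(\hat\eta_u)_{u\in\mathcal U_{k,d}}$ defined in the context satisfies $$\limsup_{\varepsilon\to0}\ \sup_{\boldsymbol\eta\in\mathcal H^d_{k,\beta}}\ \sup_{\boldsymbol\theta\in\Theta^d_{k,\sigma}(r_{\varepsilon,k})}\ \mathrm E_{\boldsymbol\theta,\boldsymbol\eta}\sum_{u\in\mathcal U_{k,d}}|\eta_u-\hat\eta_u|=0 .$$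
   Context: Model. For $1\le k\le d$ let $\mathcal U_{k,d}$ be the set of subsets $u\subseteq\{1,\dots,d\}$ with $\#u=k$. For $u\in\mathcal U_{k,d}$ let $\mathring{\mathbb Z}_u=\{\boldsymbol\ell=(l_1,\dots,l_d)\in\mathbb Z^d: l_j=0 \text{ for } j\notin u,\ l_j\neq0\text{ for } j\in u\}$, and $\mathring{\mathbb Z}^k=(\mathbb Z\setminus\{0\})^k$. For $\boldsymbol\ell$ in either set put $c_{\boldsymbol\ell}^2=\bigl(\sum_j(2\pi l_j)^2\bigr)^{\sigma}$. One observes, for noise level $\varepsilon>0$, $$X_{\boldsymbol\ell}=\eta_u\theta_{\boldsymbol\ell}(u)+\varepsilon\xi_{\boldsymbol\ell},\qquad \boldsymbol\ell\in\mathring{\mathbb Z}_u,\ u\in\mathcal U_{k,d},$$ with $\xi_{\boldsymbol\ell}$ i.i.d. $N(0,1)$ (the sequence-space form of the Gaussian white noise model with sparse regression function $f=\sum_u\eta_uf_u$). The unknown deterministic $\boldsymbol\eta=(\eta_u)$ lies in $\mathcal H^d_{k,\beta}=\{\boldsymbol\eta:\eta_u\in\{0,1\},\ \sum_u\eta_u=\binom dk^{1-\beta}(1+o(1))\text{ as }\varepsilon\to0\}$. For $r>0$, $$\mathring\Theta_{\mathbf c_u}(r)=\Bigl\{(\theta_{\boldsymbol\ell}(u))_{\boldsymbol\ell\in\mathring{\mathbb Z}_u}:\sum_{\boldsymbol\ell}\theta_{\boldsymbol\ell}^2(u)c_{\boldsymbol\ell}^2\le1,\ \sum_{\boldsymbol\ell}\theta^2_{\boldsymbol\ell}(u)\ge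 r^2\Bigr\},$$ and $\Theta^d_{k,\sigma}(r)=\{(\boldsymbol\theta_u)_{u\in\mathcal U_{k,d}}:\boldsymbol\theta_u\in\mathring\Theta_{\mathbf c_u}(r)\ \forall u\}$. $\mathrm E_{\boldsymbol\theta,\boldsymbol\eta}$ is expectation under parameters $\boldsymbol\theta,\boldsymbol\eta$. Extremal problem. With $\mathring\Theta_{\mathbf c_k}(r)$ the analogous set indexed by $\mathring{\mathbb Z}^k$, let $$a^2_{\varepsilon,k}(r)=\frac1{2\varepsilon^4}\inf_{\boldsymbol\theta\in\mathring\Theta_{\mathbf c_k}(r)}\sum_{\boldsymbol\ell\in\mathring{\mathbb Z}^k}\theta_{\boldsymbol\ell}^4,$$ which equals the same infimum over $\mathring\Theta_{\mathbf c_u}(r)$. Let $(\theta^*_{\boldsymbol\ell}(r))_{\boldsymbol\ell\in\mathring{\mathbb Z}_u}$ be the minimizer ($[\theta^*_{\boldsymbol\ell}(r)]^2=a_0^2(1-(c_{\boldsymbol\ell}/T)^2)_+$ with $a_0,T$ determined by $a_0^2\sum(1-(c_{\boldsymbol\ell}/T)^2)_+=r^2$, $a_0^2\sum c_{\boldsymbol\ell}^2(1-(c_{\boldsymbol\ell}/T)^2)_+=1$), and set $\omega_{\boldsymbol\ell}(r)=\frac{[\theta^*_{\boldsymbol\ell}(r)]^2}{2\varepsilon^2a_{\varepsilon,k}(r)}$. Selector. Let $\rho_k>0$ depend on $\varepsilon$, $M_k=\lfloor1/\rho_k\rfloor$, with $\log M_k=o(\log\binom dk)$; let $\beta_{k,m}=m\rho_k$,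 $m=1,\dots,M_k$, and define $r^*_{\varepsilon,k,m}>0$ by $a_{\varepsilon,k}(r^*_{\varepsilon,k,m})=(1+\sqrt{1-\beta_{k,m}})\sqrt{2\log\binom dk}$. For $u\in\mathcal U_{k,d}$ set $S_{u,m}=\sum_{\boldsymbol\ell\in\mathring{\mathbb Z}_u}\omega_{\boldsymbol\ell}(r^*_{\varepsilon,k,m})[(X_{\boldsymbol\ell}/\varepsilon)^2-1]$; let $\epsilon=\epsilon_\varepsilon>0$ with $\epsilon\to0$ and $\epsilon\log\binom dk\to\infty$; and define $$\hat\eta_u=\max_{1\le m\le M_k}\mathbf 1\Bigl\{S_{u,m}>\sqrt{(2+\epsilon)\bigl(\log\tbinom dk+\log M_k\bigr)}\Bigr\}.$$
   Formalization: The grid step is additionally assumed to satisfy ρ_k → 0 as ε → 0; without this (e.g. ρ_k = 2, so M_k = 0, or ρ_k = 1, where the only grid value is 1) the selector is undefined or misses active components and the claim fails. *)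

theory Defs
  imports "HOL-Probability.Probability"
begin

text \<open>Multi-indices l in Z^d are represented as functions nat => int (coordinates 1..d).\<close>

definition Ucal :: "nat \<Rightarrow> nat \<Rightarrow> nat set set" where
  "Ucal k d = {u. u \<subseteq> {1..d} \<and> card u = k}"

definition Zring :: "nat set \<Rightarrow> (nat \<Rightarrow> int) set" where
  "Zring u = {l. (\<forall>j. j \<notin> u \<longrightarrow> l j = 0) \<and> (\<forall>j\<in>u. l j \<noteq> 0)}"

definition supp :: "(nat \<Rightarrow> int) \<Rightarrow> nat set" where
  "supp l = {j. l j \<noteq> 0}"

definition csq :: "real \<Rightarrow> (nat \<Rightarrow> int) \<Rightarrow> real" where
  "csq \<sigma> l = (\<Sum>j\<in>supp l. (2 * pi * of_int (l j))^2) powr \<sigma>"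

definition Theta_c :: "real \<Rightarrow> nat set \<Rightarrow> real \<Rightarrow> ((nat \<Rightarrow> int) \<Rightarrow> real) set" where
  "Theta_c \<sigma> u r = {\<theta>.
      (\<integral>\<^sup>+ l. ennreal ((\<theta> l)^2 * csq \<sigma> l) \<partial>count_space (Zring u)) \<le> 1 \<and>
      (\<integral>\<^sup>+ l. ennreal ((\<theta> l)^2) \<partial>count_space (Zring u)) \<ge> ennreal (r^2)}"

text \<open>a^2_{eps,k}(r), with inf of the empty set = infinity\<close>
definition asq :: "real \<Rightarrow> real \<Rightarrow> nat \<Rightarrow> real \<Rightarrow> ennreal" where
  "asq \<sigma> \<epsilon> k r = (INF \<theta>\<in>Theta_c \<sigma> {1..k} r.
      (\<integral>\<^sup>+ l. ennreal ((\<theta> l)^4) \<partial>count_space (Zring {1..k})) / ennreal (2 * \<epsilon>^4))"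

definition a_eps :: "real \<Rightarrow> real \<Rightarrow> nat \<Rightarrow> real \<Rightarrow> ereal" where
  "a_eps \<sigma> \<epsilon> k r = (if asq \<sigma> \<epsilon> k r = \<top> then \<infinity> else ereal (sqrt (enn2real (asq \<sigma> \<epsilon> k r))))"

definition thstar_sq :: "real \<Rightarrow> nat set \<Rightarrow> real \<Rightarrow> (nat \<Rightarrow> int) \<Rightarrow> real" where
  "thstar_sq \<sigma> u r l =
    (let p = (THE p. fst p > 0 \<and> snd p > 0 \<and>
          (\<integral>\<^sup>+ l. ennreal (fst p * max 0 (1 - csq \<sigma> l / (snd p)^2)) \<partial>count_space (Zring u)) = ennreal (r^2) \<and>
          (\<integral>\<^sup>+ l. ennreal (csq \<sigma> l * (fst p * max 0 (1 - csq \<sigma> l / (snd p)^2))) \<partial>count_space (Zring u)) = 1)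
     in fst p * max 0 (1 - csq \<sigma> l / (snd p)^2))"

definition omega :: "real \<Rightarrow> real \<Rightarrow> nat \<Rightarrow> nat set \<Rightarrow> real \<Rightarrow> (nat \<Rightarrow> int) \<Rightarrow> real" where
  "omega \<sigma> \<epsilon> k u r l = thstar_sq \<sigma> u r l / (2 * \<epsilon>^2 * real_of_ereal (a_eps \<sigma> \<epsilon> k r))"

text \<open>r*_{eps,k,m} for the grid value b = beta_{k,m}\<close>
definition rstar :: "real \<Rightarrow> real \<Rightarrow> nat \<Rightarrow> nat \<Rightarrow> real \<Rightarrow> real" where
  "rstar \<sigma> \<epsilon> d k b = (THE r. r > 0 \<and>
      a_eps \<sigma> \<epsilon> k r = ereal ((1 + sqrt (1 - b)) * sqrt (2 * ln (real (d choose k)))))"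

definition Mk :: "real \<Rightarrow> nat" where
  "Mk \<rho> = nat \<lfloor>1 / \<rho>\<rfloor>"

definition Sstat :: "real \<Rightarrow> real \<Rightarrow> nat \<Rightarrow> nat \<Rightarrow> real \<Rightarrow> ((nat \<Rightarrow> int) \<Rightarrow> real) \<Rightarrow> nat set \<Rightarrow> nat \<Rightarrow> real" where
  "Sstat \<sigma> \<epsilon> d k \<rho> X u m =
     (\<Sum>\<^sub>\<infinity> l\<in>Zring u. omega \<sigma> \<epsilon> k u (rstar \<sigma> \<epsilon> d k (real m * \<rho>)) l * ((X l / \<epsilon>)^2 - 1))"

definition etahat :: "real \<Rightarrow> real \<Rightarrow> nat \<Rightarrow> nat \<Rightarrow> real \<Rightarrow> real \<Rightarrow> ((nat \<Rightarrow> int) \<Rightarrow> real) \<Rightarrow> nat set \<Rightarrow> real" where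
  "etahat \<sigma> \<epsilon> d k \<rho> ep X u =
     (if \<exists>m\<in>{1..Mk \<rho>}. Sstat \<sigma> \<epsilon> d k \<rho> X u m >
            sqrt ((2 + ep) * (ln (real (d choose k)) + ln (real (Mk \<rho>)))) then 1 else 0)"

definition index_set :: "nat \<Rightarrow> nat \<Rightarrow> (nat \<Rightarrow> int) set" where
  "index_set d k = (\<Union>u\<in>Ucal k d. Zring u)"

definition noise :: "nat \<Rightarrow> nat \<Rightarrow> ((nat \<Rightarrow> int) \<Rightarrow> real) measure" where
  "noise d k = PiM (index_set d k) (\<lambda>_. std_normal_distribution)"

text \<open>observations X_l = eta_u theta_l(u) + eps xi_l, for l in Zring u (u = supp l)\<close>
definition obs :: "real \<Rightarrow> (nat set \<Rightarrow> real) \<Rightarrow> (nat set \<Rightarrow> (nat \<Rightarrow> int) \<Rightarrow> real) \<Rightarrow> ((nat \<Rightarrow> int) \<Rightarrow> real) \<Rightarrow> (nat \<Rightarrow> int) \<Rightarrow> real" where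
  "obs \<epsilon> \<eta> \<theta> \<xi> l = \<eta> (supp l) * \<theta> (supp l) l + \<epsilon> * \<xi> l"

definition risk :: "real \<Rightarrow> real \<Rightarrow> nat \<Rightarrow> nat \<Rightarrow> real \<Rightarrow> real \<Rightarrow> (nat set \<Rightarrow> real) \<Rightarrow> (nat set \<Rightarrow> (nat \<Rightarrow> int) \<Rightarrow> real) \<Rightarrow> real" where
  "risk \<sigma> \<epsilon> d k \<rho> ep \<eta> \<theta> =
     (\<integral> \<xi>. (\<Sum>u\<in>Ucal k d. \<bar>\<eta> u - etahat \<sigma> \<epsilon> d k \<rho> ep (obs \<epsilon> \<eta> \<theta> \<xi>) u\<bar>) \<partial>noise d k)"

end

theory Submission
  imports Defs
begin

text \<open>The minimiser of the extremal problem is \<open>\<theta>\<^sup>2 = a (1 - c / T\<^sup>2)\<^sub>+\<close>. Integrating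
  \<open>a (1 - c / T\<^sup>2) \<le> \<theta>\<^sup>2\<close> against a feasible point gives a variational inequality, which yields
  optimality, strict monotonicity of the value in the radius, uniqueness of the minimiser, and the
  lower bound \<open>a\<^sub>\<epsilon>(r\<^sup>*)\<close> for the mean of the statistic of an active component. No lattice point
  count is needed: the \<open>2\<^sup>k\<close> sign vectors all minimise the cost and hence share the largest weight,
  so every weight is at most \<open>2\<close> to the \<open>-k/2\<close>, which beats any power of the log cardinality
  because \<open>log log d = o(k)\<close>.
  Chernoff bounds for weighted shifted chi-square sums then give a false positive
  probability that survives the union bound, thanks to the slack \<open>ep\<close> in the threshold. For false negatives
  one takes the grid point slightly below \<open>\<beta>\<close> and the exponent \<open>\<kappa> = sqrt (1 - \<beta>\<^sub>m) sqrt (2 L)\<close>,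
  which is optimal for a threshold \<open>sqrt (2 L)\<close>, where \<open>L\<close> is the log cardinality.\<close>

section \<open>The extremal problem\<close>

text \<open>\<open>rstar\<close> and \<open>thstar_sq\<close> are definite descriptions, so nothing
  is known about the weights before existence and uniqueness of the radius and of the pair
  \<open>(a, T)\<close> are established. The pair is the delicate part: if only sign vectors lie
  below the cutoff, infinitely many pairs give the same weights. The next value of the squared norm
  after \<open>k\<close> is \<open>k + 3\<close>, so the cutoff has to pass
  \<open>level_cost \<sigma> (k + 3)\<close>. It does so when the target value
  \<open>2 * \<epsilon>^4 * A^2\<close> is small, which the growth condition on the log cardinality
  provides. The squared weights sum to 1/2 and a centred squared standard normal has variance 2, so
  the statistic has unit variance under pure noise. Its tails are then bounded nearly as those of
  N(0, 1) for an inactive component, and from below as those of N(A, 1) with A = (1 + s) sqrt (2 L)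
  for an active one, where s^2 is 1 minus the grid value. A threshold near sqrt (2 L) is crossed by
  noise with probability about exp (- L) and missed by a signal with probability about exp (- s^2
  L), against exp ((1 - \<beta>) L) active components.\<close>

locale extremal_problem =
  fixes I :: "'i set" and c :: "'i \<Rightarrow> real"
  assumes c_pos: "l \<in> I \<Longrightarrow> 0 < c l"
    and finite_sublevel: "finite {l \<in> I. c l < B}"
begin

definition wt :: "real \<Rightarrow> 'i \<Rightarrow> real" where
  "wt T l = max 0 (1 - c l / T^2)"

definition sublevel :: "real \<Rightarrow> 'i set" where
  "sublevel T = {l \<in> I. c l < T^2}"

text \<open>Stationarity in terms of squares: \<open>a\<close> is the squared amplitude,
  \<open>R\<close> the squared radius, and both constraints are active. The finite sums replace the
  integrals in \<open>thstar_sq\<close>; \<open>critical_iff\<close> identifies the two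
  forms.\<close>

definition critical :: "real \<Rightarrow> real \<Rightarrow> real \<Rightarrow> bool" where
  "critical a T R \<longleftrightarrow> 0 < a \<and> 0 < T \<and> a * (\<Sum>l\<in>sublevel T. wt T l) = R \<and>
     a * (\<Sum>l\<in>sublevel T. c l * wt T l) = 1"

definition feasible :: "real \<Rightarrow> ('i \<Rightarrow> real) set" where
  "feasible r = {\<theta>. (\<integral>\<^sup>+ l. ennreal ((\<theta> l)^2 * c l) \<partial>count_space I) \<le> 1 \<and>
      (\<integral>\<^sup>+ l. ennreal ((\<theta> l)^2) \<partial>count_space I) \<ge> ennreal (r^2)}"

definition optval :: "real \<Rightarrow> ennreal" where
  "optval r = (INF \<theta>\<in>feasible r. \<integral>\<^sup>+ l. ennreal ((\<theta> l)^4) \<partial>count_space I)"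

lemma finite_sub [simp]: "finite (sublevel T)"
  unfolding sublevel_def by (rule finite_sublevel)

lemma sublevel_subset: "sublevel T \<subseteq> I"
  by (auto simp: sublevel_def)

lemma wt_nonneg [simp]: "0 \<le> wt T l"
  by (simp add: wt_def)

lemma wt_eq: "0 < T \<Longrightarrow> l \<in> sublevel T \<Longrightarrow> wt T l = 1 - c l / T^2"
  by (auto simp: wt_def sublevel_def max_def field_simps)

lemma wt_pos: "0 < T \<Longrightarrow> l \<in> sublevel T \<Longrightarrow> 0 < wt T l"
  by (auto simp: wt_def sublevel_def max_def field_simps)

lemma wt_outside: "0 < T \<Longrightarrow> l \<in> I \<Longrightarrow> l \<notin> sublevel T \<Longrightarrow> wt T l = 0"
  by (auto simp: wt_def sublevel_def max_def field_simps)

lemma nn_integral_finite_support: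
  assumes "finite S" "S \<subseteq> I" "\<And>l. l \<in> I \<Longrightarrow> 0 \<le> f l" "\<And>l. l \<in> I - S \<Longrightarrow> f l = 0"
  shows "(\<integral>\<^sup>+ l. ennreal (f l) \<partial>count_space I) = ennreal (\<Sum>l\<in>S. f l)"
proof -
  have "(\<integral>\<^sup>+ l. ennreal (f l) \<partial>count_space I) = (\<Sum>l\<in>S. ennreal (f l))"
    by (rule nn_integral_count_space') (use assms in auto)
  also have "\<dots> = ennreal (\<Sum>l\<in>S. f l)"
    by (rule sum_ennreal) (use assms in auto)
  finally show ?thesis .
qed

lemma critical_iff:
  assumes "0 < a" "0 < T" "0 \<le> R"
  shows "critical a T R \<longleftrightarrow>
    (\<integral>\<^sup>+ l. ennreal (a * max 0 (1 - c l / T^2)) \<partial>count_space I) = ennreal R \<and>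
    (\<integral>\<^sup>+ l. ennreal (c l * (a * max 0 (1 - c l / T^2))) \<partial>count_space I) = 1"
proof -
  have 1: "(\<integral>\<^sup>+ l. ennreal (a * max 0 (1 - c l / T^2)) \<partial>count_space I)
      = ennreal (\<Sum>l\<in>sublevel T. a * wt T l)"
    unfolding wt_def[symmetric]
    by (rule nn_integral_finite_support) (use assms sublevel_subset wt_outside in auto)
  have 2: "(\<integral>\<^sup>+ l. ennreal (c l * (a * max 0 (1 - c l / T^2))) \<partial>count_space I)
      = ennreal (\<Sum>l\<in>sublevel T. c l * (a * wt T l))"
    unfolding wt_def[symmetric]
    by (rule nn_integral_finite_support)
      (use assms sublevel_subset wt_outside in \<open>auto simp: c_pos less_imp_le\<close>)
  have 3: "(\<Sum>l\<in>sublevel T. a * wt T l) = a * (\<Sum>l\<in>sublevel T. wt T l)"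
    "(\<Sum>l\<in>sublevel T. c l * (a * wt T l)) = a * (\<Sum>l\<in>sublevel T. c l * wt T l)"
    by (auto simp: sum_distrib_left mult_ac)
  have 4: "0 \<le> (\<Sum>l\<in>sublevel T. wt T l)"  "0 \<le> (\<Sum>l\<in>sublevel T. c l * wt T l)"
    by (auto intro!: sum_nonneg mult_nonneg_nonneg simp: sublevel_def c_pos less_imp_le)
  show ?thesis
    unfolding critical_def 1 2 3 using assms 4 by (auto simp: ennreal_inj)
qed

section \<open>Optimality of critical points and strict monotonicity of the value\<close>

lemma critical_pos:
  assumes "critical a T R"
  shows "0 < a" "0 < T" "0 < R" "sublevel T \<noteq> {}"
proof -
  show a: "0 < a" and T: "0 < T" using assms by (auto simp: critical_def)
  show ne: "sublevel T \<noteq> {}" using assms by (auto simp: critical_def)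
  have "0 < (\<Sum>l\<in>sublevel T. wt T l)" by (rule sum_pos) (use ne T wt_pos in auto)
  then show "0 < R" using assms a unfolding critical_def by (metis mult_pos_pos)
qed

text \<open>On the sublevel set a squared term is \<open>a * (a * wt T l) * (1 - c l / T^2)\<close>,
  so the two constraints evaluate the sum. This is the case of equality in
  \<open>critical_variational\<close>.\<close>

lemma critical_sum_squares:
  assumes "critical a T R"
  shows "(\<Sum>l\<in>sublevel T. (a * wt T l)^2) = a * (R - 1 / T^2)"
proof -
  have T: "0 < T" using assms by (auto simp: critical_def)
  have "(\<Sum>l\<in>sublevel T. (a * wt T l)^2) = (\<Sum>l\<in>sublevel T. a * (a * wt T l - a * (c l * wt T l) / T^2))"
    by (rule sum.cong) (auto simp: wt_eq T power2_eq_square field_simps)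
  also have "\<dots> = a * (a * (\<Sum>l\<in>sublevel T. wt T l) - a * (\<Sum>l\<in>sublevel T. c l * wt T l) / T^2)"
    by (simp add: sum_distrib_left sum_subtractf right_diff_distrib sum_divide_distrib)
  finally show ?thesis using assms by (simp add: critical_def)
qed

lemma critical_sum_squares_pos:
  assumes "critical a T R"
  shows "0 < (\<Sum>l\<in>sublevel T. (a * wt T l)^2)"
  using critical_pos[OF assms] wt_pos[of T] by (intro sum_pos) (auto simp: less_imp_neq[symmetric])

lemma critical_variational:
  assumes cr: "critical a T R" and f: "\<theta> \<in> feasible r"
  shows "(\<Sum>l\<in>sublevel T. a * wt T l * (\<theta> l)^2) \<ge> a * (r^2 - 1 / T^2)"
proof -
  have a: "0 < a" and T: "0 < T" using critical_pos[OF cr] by auto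
  \<comment> \<open>The chain stays in \<open>ennreal\<close>, where an infinite mass of
    \<open>\<theta>\<close> would do no harm; only the final finite sum returns to the
    reals.\<close>
  have "ennreal (a * r^2) = ennreal a * ennreal (r^2)"
    using a by (simp add: ennreal_mult')
  also have "\<dots> \<le> ennreal a * (\<integral>\<^sup>+ l. ennreal ((\<theta> l)^2) \<partial>count_space I)"
    using f by (intro mult_left_mono) (auto simp: feasible_def)
  also have "\<dots> = (\<integral>\<^sup>+ l. ennreal a * ennreal ((\<theta> l)^2) \<partial>count_space I)"
    by (subst nn_integral_cmult) auto
  also have "\<dots> \<le> (\<integral>\<^sup>+ l. ennreal (a * wt T l * (\<theta> l)^2) + ennreal (a / T^2) * ennreal ((\<theta> l)^2 * c l) \<partial>count_space I)"
  proof (rule nn_integral_mono)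
    fix l assume "l \<in> space (count_space I)"
    then have l: "0 < c l" by (simp add: c_pos)
    \<comment> \<open>\<open>a / T^2\<close> acts as the multiplier of the energy constraint. Where
      the weight is truncated, \<open>c l / T^2 \<ge> 1\<close>, so the energy charge alone covers
      \<open>a\<close>.\<close>
    have "a * 1 * (\<theta> l)^2 \<le> a * (wt T l + c l / T^2) * (\<theta> l)^2"
      using a T by (intro mult_right_mono mult_left_mono) (auto simp: wt_def)
    then have "a * (\<theta> l)^2 \<le> a * wt T l * (\<theta> l)^2 + a / T^2 * ((\<theta> l)^2 * c l)"
      by (simp add: algebra_simps)
    then show "ennreal a * ennreal ((\<theta> l)^2) \<le> ennreal (a * wt T l * (\<theta> l)^2) + ennreal (a / T^2) * ennreal ((\<theta> l)^2 * c l)"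
      using a l by (simp add: ennreal_mult'[symmetric] ennreal_plus[symmetric] ennreal_leI del: ennreal_plus)
  qed
  also have "\<dots> = (\<integral>\<^sup>+ l. ennreal (a * wt T l * (\<theta> l)^2) \<partial>count_space I) + ennreal (a / T^2) * (\<integral>\<^sup>+ l. ennreal ((\<theta> l)^2 * c l) \<partial>count_space I)"
    by (subst nn_integral_add) (auto simp: nn_integral_cmult)
  also have "\<dots> \<le> ennreal (\<Sum>l\<in>sublevel T. a * wt T l * (\<theta> l)^2) + ennreal (a / T^2) * 1"
  proof (intro add_mono mult_left_mono)
    show "(\<integral>\<^sup>+ l. ennreal (a * wt T l * (\<theta> l)^2) \<partial>count_space I) \<le> ennreal (\<Sum>l\<in>sublevel T. a * wt T l * (\<theta> l)^2)"
      by (subst nn_integral_finite_support[of "sublevel T"]) (use a T sublevel_subset wt_outside in auto)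
  qed (use f in \<open>auto simp: feasible_def\<close>)
  also have "\<dots> = ennreal ((\<Sum>l\<in>sublevel T. a * wt T l * (\<theta> l)^2) + a / T^2)"
    using a by (subst ennreal_plus) (auto intro!: sum_nonneg)
  finally have "a * r^2 \<le> (\<Sum>l\<in>sublevel T. a * wt T l * (\<theta> l)^2) + a / T^2"
    using a by (subst (asm) ennreal_le_iff) (auto intro!: sum_nonneg add_nonneg_nonneg)
  then show ?thesis by (simp add: algebra_simps)
qed

text \<open>Cauchy-Schwarz between the critical weights and \<open>\<theta>^2\<close>, fed with the
  variational inequality. The excess \<open>a * (r^2 - R)\<close> is kept because it makes the bound
  strict beyond \<open>sqrt R\<close>.\<close>

lemma critical_lower_bound:
  assumes cr: "critical a T R" and f: "\<theta> \<in> feasible r" and r: "R \<le> r^2"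
  defines "V \<equiv> \<Sum>l\<in>sublevel T. (a * wt T l)^2"
  shows "ennreal ((V + a * (r^2 - R))^2 / V) \<le> (\<integral>\<^sup>+ l. ennreal ((\<theta> l)^4) \<partial>count_space I)"
proof -
  have V: "0 < V" unfolding V_def by (rule critical_sum_squares_pos[OF cr])
  have a: "0 < a" using critical_pos[OF cr] by auto
  let ?P = "\<Sum>l\<in>sublevel T. a * wt T l * (\<theta> l)^2"
  have "V + a * (r^2 - R) = a * (r^2 - 1 / T^2)"
    unfolding V_def critical_sum_squares[OF cr] by (simp add: algebra_simps)
  then have P: "V + a * (r^2 - R) \<le> ?P" using critical_variational[OF cr f] by simp
  have "(V + a * (r^2 - R))^2 \<le> ?P^2"
    by (rule power_mono[OF P]) (use V a r in auto)
  also have "\<dots> \<le> V * (\<Sum>l\<in>sublevel T. ((\<theta> l)^2)^2)"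
    unfolding V_def by (rule Cauchy_Schwarz_ineq_sum)
  finally have "(V + a * (r^2 - R))^2 / V \<le> (\<Sum>l\<in>sublevel T. (\<theta> l)^4)"
    using V by (simp add: field_simps power_mult[symmetric])
  then have "ennreal ((V + a * (r^2 - R))^2 / V) \<le> ennreal (\<Sum>l\<in>sublevel T. (\<theta> l)^4)"
    by (rule ennreal_leI)
  also have "\<dots> = (\<integral>\<^sup>+ l. ennreal ((\<theta> l)^4 * indicator (sublevel T) l) \<partial>count_space I)"
    by (subst nn_integral_finite_support[of "sublevel T"]) (use sublevel_subset in auto)
  also have "\<dots> \<le> (\<integral>\<^sup>+ l. ennreal ((\<theta> l)^4) \<partial>count_space I)"
    by (rule nn_integral_mono) (auto simp: indicator_def)
  finally show ?thesis .
qed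

text \<open>Multiplying the critical squares by \<open>q \<le> 1\<close> spends only energy
  \<open>q\<close>, reaches exactly the squared radius \<open>q * R\<close>, and multiplies the
  quartic sum by \<open>q^2\<close>.\<close>

lemma critical_scaled:
  assumes cr: "critical a T R" and q: "0 \<le> q" "q \<le> 1" and r: "r^2 = q * R"
  shows "optval r \<le> ennreal (q^2 * (\<Sum>l\<in>sublevel T. (a * wt T l)^2))"
proof -
  have a: "0 < a" and T: "0 < T" using critical_pos[OF cr] by auto
  define \<theta> where "\<theta> l = sqrt (q * (a * wt T l))" for l
  have sq: "(\<theta> l)^2 = q * (a * wt T l)" for l
    using a q by (simp add: \<theta>_def)
  have fo: "(\<theta> l)^4 = (q * (a * wt T l))^2" for l
    by (metis sq numeral_Bit0 mult_2 power_add power2_eq_square)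
  have "(\<integral>\<^sup>+ l. ennreal ((\<theta> l)^2 * c l) \<partial>count_space I) = ennreal (\<Sum>l\<in>sublevel T. q * (a * wt T l) * c l)"
    unfolding sq by (rule nn_integral_finite_support)
      (use a q T sublevel_subset wt_outside in \<open>auto simp: c_pos less_imp_le\<close>)
  also have "(\<Sum>l\<in>sublevel T. q * (a * wt T l) * c l) = q * (a * (\<Sum>l\<in>sublevel T. c l * wt T l))"
    by (simp add: sum_distrib_left mult_ac)
  also have "\<dots> = q" using cr by (simp add: critical_def)
  finally have 1: "(\<integral>\<^sup>+ l. ennreal ((\<theta> l)^2 * c l) \<partial>count_space I) \<le> 1" using q by simp
  have "(\<integral>\<^sup>+ l. ennreal ((\<theta> l)^2) \<partial>count_space I) = ennreal (\<Sum>l\<in>sublevel T. q * (a * wt T l))"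
    unfolding sq by (rule nn_integral_finite_support)
      (use a q T sublevel_subset wt_outside in auto)
  also have "(\<Sum>l\<in>sublevel T. q * (a * wt T l)) = q * (a * (\<Sum>l\<in>sublevel T. wt T l))"
    by (simp add: sum_distrib_left mult_ac)
  also have "\<dots> = r^2" using cr r by (simp add: critical_def)
  finally have "\<theta> \<in> feasible r" using 1 by (simp add: feasible_def)
  then have "optval r \<le> (\<integral>\<^sup>+ l. ennreal ((\<theta> l)^4) \<partial>count_space I)"
    unfolding optval_def by (rule INF_lower)
  also have "\<dots> = ennreal (\<Sum>l\<in>sublevel T. (q * (a * wt T l))^2)"
    unfolding fo by (rule nn_integral_finite_support)
      (use a q T sublevel_subset wt_outside in auto)
  also have "(\<Sum>l\<in>sublevel T. (q * (a * wt T l))^2) = q^2 * (\<Sum>l\<in>sublevel T. (a * wt T l)^2)"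
    by (simp add: sum_distrib_left power_mult_distrib)
  finally show ?thesis .
qed

lemma optval_critical:
  assumes cr: "critical a T R" and r: "r^2 = R"
  shows "optval r = ennreal (\<Sum>l\<in>sublevel T. (a * wt T l)^2)" (is "_ = ennreal ?V")
proof (rule antisym)
  show "optval r \<le> ennreal ?V"
    using critical_scaled[OF cr, of 1 r] r by simp
  show "ennreal ?V \<le> optval r"
    unfolding optval_def
  proof (rule INF_greatest)
    fix \<theta> assume "\<theta> \<in> feasible r"
    from critical_lower_bound[OF cr this] r critical_sum_squares_pos[OF cr]
    show "ennreal ?V \<le> (\<integral>\<^sup>+ l. ennreal ((\<theta> l)^4) \<partial>count_space I)"
      by (simp add: power2_eq_square)
  qed
qed

text \<open>The scaling factor \<open>r^2 / R\<close> is below 1 and enters squared, hence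
  strictness. Together with \<open>optval_greater\<close> this leaves a single radius with a given
  critical value, as \<open>rstar\<close> demands.\<close>

lemma optval_less:
  assumes cr: "critical a T R" and r: "0 \<le> r" "r^2 < R"
  shows "optval r < ennreal (\<Sum>l\<in>sublevel T. (a * wt T l)^2)" (is "_ < ennreal ?V")
proof -
  have R: "0 < R" and V: "0 < ?V" using critical_pos[OF cr] critical_sum_squares_pos[OF cr] by auto
  have "r^2 / R < 1" using r R by simp
  then have "(r^2/R)^2 < 1" using R by (simp add: power_less_one_iff abs_square_less_1)
  then have "(r^2/R)^2 * ?V < ?V" using V by simp
  moreover have "optval r \<le> ennreal ((r^2/R)^2 * ?V)"
    by (rule critical_scaled[OF cr]) (use r R in auto)
  ultimately show ?thesis using V by (meson ennreal_lessI le_less_trans)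
qed

lemma optval_greater:
  assumes cr: "critical a T R" and r: "R < r^2"
  shows "ennreal (\<Sum>l\<in>sublevel T. (a * wt T l)^2) < optval r" (is "ennreal ?V < _")
proof -
  have a: "0 < a" and V: "0 < ?V" using critical_pos[OF cr] critical_sum_squares_pos[OF cr] by auto
  let ?D = "a * (r^2 - R)"
  have D: "0 < ?D" using a r by simp
  have "?V^2 < (?V + ?D)^2" by (rule power_strict_mono) (use V D in auto)
  then have "?V < (?V + ?D)^2 / ?V" using V by (simp add: field_simps power2_eq_square)
  then have "ennreal ?V < ennreal ((?V + ?D)^2 / ?V)" using V by (intro ennreal_lessI) auto
  also have "\<dots> \<le> optval r"
    unfolding optval_def
    by (rule INF_greatest, rule critical_lower_bound[OF cr]) (use r in auto)
  finally show ?thesis .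
qed

section \<open>Uniqueness and existence of critical points\<close>

lemma critical_feasible:
  assumes cr: "critical a T (r^2)"
  shows "(\<lambda>l. sqrt (a * wt T l)) \<in> feasible r"
proof -
  have a: "0 < a" and T: "0 < T" using critical_pos[OF cr] by auto
  have sq: "(sqrt (a * wt T l))^2 = a * wt T l" for l using a by simp
  have "critical a T (r^2)" by fact
  then show ?thesis
    unfolding feasible_def mem_Collect_eq sq
    by (subst (asm) critical_iff) (use a T in \<open>auto simp: wt_def[symmetric] mult_ac\<close>)
qed

text \<open>Two critical points share the same weights, because each satisfies the variational
  inequality of the other; an affine function is then recovered from two of its values.\<close>
lemma critical_unique:
  assumes cr: "critical a T (r^2)" and cr': "critical a' T' (r^2)"
    and ne: "l1 \<in> sublevel T" "l2 \<in> sublevel T" "c l1 \<noteq> c l2"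
  shows "a = a'" "T = T'"
proof -
  note p = critical_pos[OF cr] and p' = critical_pos[OF cr']
  let ?U = "sublevel T \<union> sublevel T'"
  define x where "x l = a * wt T l" for l
  define y where "y l = a' * wt T' l" for l
  \<comment> \<open>Both weight families are extended by zero to the common finite set
    \<open>?U\<close>, where they can be compared as vectors.\<close>
  have ex: "(\<Sum>l\<in>sublevel T. x l * f l) = (\<Sum>l\<in>?U. x l * f l)" for f
    by (rule sum.mono_neutral_left)
      (use p p' wt_outside sublevel_subset in \<open>fastforce simp: x_def\<close>)+
  have ey: "(\<Sum>l\<in>sublevel T'. y l * f l) = (\<Sum>l\<in>?U. y l * f l)" for f
    by (rule sum.mono_neutral_left)
      (use p p' wt_outside sublevel_subset in \<open>fastforce simp: y_def\<close>)+
  have x0: "0 \<le> x l" "0 \<le> y l" for l using p p' by (auto simp: x_def y_def)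
  have "(\<Sum>l\<in>sublevel T. x l * x l) \<le> (\<Sum>l\<in>sublevel T. x l * y l)"
    using critical_variational[OF cr critical_feasible[OF cr']] critical_sum_squares[OF cr] x0
    by (simp add: x_def y_def power2_eq_square)
  then have 1: "(\<Sum>l\<in>?U. x l * x l) \<le> (\<Sum>l\<in>?U. x l * y l)" by (simp only: ex)
  have "(\<Sum>l\<in>sublevel T'. y l * y l) \<le> (\<Sum>l\<in>sublevel T'. y l * x l)"
    using critical_variational[OF cr' critical_feasible[OF cr]] critical_sum_squares[OF cr'] x0
    by (simp add: x_def y_def power2_eq_square)
  then have 2: "(\<Sum>l\<in>?U. y l * y l) \<le> (\<Sum>l\<in>?U. y l * x l)" by (simp only: ey)
  \<comment> \<open>Each squared norm is at most the inner product, so the squared distance is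
    nonpositive.\<close>
  have "(\<Sum>l\<in>?U. (x l - y l)^2) = (\<Sum>l\<in>?U. x l * x l) - (\<Sum>l\<in>?U. x l * y l) + ((\<Sum>l\<in>?U. y l * y l) - (\<Sum>l\<in>?U. y l * x l))"
    by (simp add: sum_subtractf[symmetric] sum.distrib[symmetric] power2_eq_square algebra_simps)
  then have "(\<Sum>l\<in>?U. (x l - y l)^2) \<le> 0" using 1 2 by simp
  then have "(\<Sum>l\<in>?U. (x l - y l)^2) = 0" by (intro antisym sum_nonneg) auto
  then have eq: "x l = y l" if "l \<in> sublevel T" for l
    using that by (subst (asm) sum_nonneg_eq_0_iff) auto
  \<comment> \<open>Equal weights give an affine identity only where neither is truncated.
    Positivity of \<open>x l\<close> passes to \<open>y l\<close>, so \<open>l\<close> lies below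
    both cutoffs.\<close>
  have aff: "a - a / T^2 * c l = a' - a' / T'^2 * c l" if l: "l \<in> sublevel T" for l
  proof -
    have "0 < x l" using l p wt_pos by (simp add: x_def)
    then have "0 < y l" using eq l by simp
    then have "0 < wt T' l" using p' by (simp add: y_def zero_less_mult_iff)
    then have "l \<in> sublevel T'"
      using l p' wt_outside sublevel_subset by (metis less_irrefl subsetD)
    then show ?thesis using eq[OF l] l p p' by (simp add: x_def y_def wt_eq algebra_simps)
  qed
  have "(a / T^2 - a' / T'^2) * (c l1 - c l2) = 0"
    unfolding left_diff_distrib right_diff_distrib using aff[OF ne(1)] aff[OF ne(2)] by linarith
  then have s: "a / T^2 = a' / T'^2" using ne(3) by simp
  then show "a = a'" using aff[OF ne(1)] by simp
  then have "T^2 = T'^2" using s p p' by (simp add: field_simps)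
  then show "T = T'" using p p' by (simp add: power2_eq_iff_nonneg)
qed

text \<open>The critical points form a curve parametrised by the cutoff, so that every small
  value of the objective is attained by the intermediate value theorem.\<close>
lemma critical_exists:
  assumes inf: "infinite I" and T0: "0 < T0" and ne: "sublevel T0 \<noteq> {}" and v: "0 < v"
    and less: "v * (\<Sum>l\<in>sublevel T0. c l * wt T0 l)^2 < (\<Sum>l\<in>sublevel T0. (wt T0 l)^2)"
  obtains a T R where "critical a T R" "T0 < T" "(\<Sum>l\<in>sublevel T. (a * wt T l)^2) = v"
proof -
  obtain l0 where l0: "l0 \<in> I" "c l0 < T0^2" using ne by (auto simp: sublevel_def)
  \<comment> \<open>With \<open>a\<close> the reciprocal of the energy sum, the energy constraint
    holds at every cutoff from \<open>T0\<close> on, and the quartic sum is \<open>v\<close> exactly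
    when \<open>F T = 0\<close>. The hypothesis \<open>less\<close> says that \<open>F\<close> is
    positive at \<open>T0\<close>; what remains is a cutoff where it is not.\<close>
  define F where "F T = (\<Sum>l\<in>sublevel T. (wt T l)^2) - v * (\<Sum>l\<in>sublevel T. c l * wt T l)^2" for T
  obtain m where m: "0 < m" "\<And>l. l \<in> I \<Longrightarrow> m \<le> c l"
  proof (rule that[of "Min (c ` {l\<in>I. c l < T0^2})"])
    let ?S = "{l\<in>I. c l < T0^2}"
    have ne: "c ` ?S \<noteq> {}" and fi: "finite (c ` ?S)" using l0 finite_sublevel by auto
    show "0 < Min (c ` ?S)" using Min_gr_iff[OF fi ne] c_pos by auto
    fix l assume l: "l \<in> I"
    show "Min (c ` ?S) \<le> c l"
    proof (cases "c l < T0^2")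
      case True then show ?thesis using l fi by auto
    next
      case False
      have "Min (c ` ?S) \<le> c l0" using l0 fi by auto
      then show ?thesis using False l0 by linarith
    qed
  qed
  \<comment> \<open>\<open>n\<close> points of weight at least 1/2 lift the total weight above
    \<open>1 / (v * m^2)\<close>. As all costs are at least \<open>m\<close>, the squared energy sum
    then dominates in \<open>F\<close>.\<close>
  obtain n :: nat where n: "1 / (v * m^2) * 2 < real n" using reals_Archimedean2 by blast
  obtain A where A: "A \<subseteq> I" "finite A" "card A = n"
    using infinite_arbitrarily_large[OF inf] by blast
  \<comment> \<open>\<open>T1^2 \<ge> T1 \<ge> 2 * c l\<close> for every \<open>l\<close> in
    \<open>A\<close>, which yields the weight 1/2.\<close>
  define T1 where "T1 = T0 + 1 + (\<Sum>l\<in>A. c l) * 2"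
  have sA: "0 \<le> (\<Sum>l\<in>A. c l)" using A c_pos by (intro sum_nonneg) (auto simp: less_imp_le)
  have T1: "T0 < T1" "1 \<le> T1" using sA T0 by (auto simp: T1_def)
  have half: "1/2 \<le> wt T1 l" if "l \<in> A" for l
  proof -
    have "c l \<le> (\<Sum>l\<in>A. c l)" using that A c_pos by (intro member_le_sum) (auto simp: less_imp_le)
    then have "2 * c l \<le> T1" using T0 by (simp add: T1_def)
    also have "T1 \<le> T1^2" using T1 by (simp add: power2_eq_square)
    finally have "1/2 \<le> 1 - c l / T1^2" using T1 by (simp add: field_simps)
    then show ?thesis unfolding wt_def by linarith
  qed
  have AT: "A \<subseteq> sublevel T1"
  proof
    fix l assume "l \<in> A"
    then show "l \<in> sublevel T1" using half[of l] wt_outside[of T1 l] A T1 T0 by fastforce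
  qed
  let ?W = "\<Sum>l\<in>sublevel T1. wt T1 l"
  have "(\<Sum>l\<in>A. 1/2) \<le> (\<Sum>l\<in>A. wt T1 l)" by (rule sum_mono) (rule half)
  also have "\<dots> \<le> ?W" by (rule sum_mono2) (use AT in auto)
  finally have "real n / 2 \<le> ?W" using A by simp
  then have W: "1 / (v * m^2) < ?W" using n by linarith
  have W0: "0 < ?W" using W v m by (meson divide_pos_pos less_trans mult_pos_pos zero_less_one zero_less_power)
  have "(\<Sum>l\<in>sublevel T1. (wt T1 l)^2) \<le> ?W"
  proof (rule sum_mono)
    fix l assume l: "l \<in> sublevel T1"
    then have "wt T1 l \<le> 1" using c_pos[of l] by (auto simp: wt_def sublevel_def)
    then show "(wt T1 l)^2 \<le> wt T1 l" by (simp add: power2_eq_square mult_left_le)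
  qed
  also have "?W \<le> v * (m * ?W)^2"
  proof -
    have "1 < ?W * (v * m^2)" using W v m by (simp add: pos_divide_less_eq)
    then have "?W * 1 \<le> ?W * (?W * (v * m^2))" using W0 by (intro mult_left_mono) auto
    then show ?thesis by (simp add: power2_eq_square mult_ac)
  qed
  also have "v * (m * ?W)^2 \<le> v * (\<Sum>l\<in>sublevel T1. c l * wt T1 l)^2"
  proof (intro mult_left_mono power_mono)
    show "m * ?W \<le> (\<Sum>l\<in>sublevel T1. c l * wt T1 l)"
      unfolding sum_distrib_left by (intro sum_mono mult_right_mono m) (auto simp: sublevel_def)
  qed (use v m W0 in auto)
  finally have F1: "F T1 \<le> 0" by (simp add: F_def)
  have F0: "0 < F T0" using less by (simp add: F_def)
  \<comment> \<open>The summation range of \<open>F\<close> varies with the cutoff. Over the fixed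
    range \<open>sublevel T1\<close> the sums are visibly continuous, and the added terms vanish;
    \<open>e \<ge> 1\<close> matters because \<open>0 ^ 0 = 1\<close>.\<close>
  have ext: "(\<Sum>l\<in>sublevel T. f l * wt T l ^ e) = (\<Sum>l\<in>sublevel T1. f l * wt T l ^ e)"
    if "T0 \<le> T" "T \<le> T1" "e \<ge> 1" for T f and e :: nat
  proof (rule sum.mono_neutral_left)
    have "T^2 \<le> T1^2" using that T0 by (intro power_mono) auto
    then show "sublevel T \<subseteq> sublevel T1" by (auto simp: sublevel_def)
    show "\<forall>i\<in>sublevel T1 - sublevel T. f i * wt T i ^ e = 0"
      using that T0 wt_outside[of T] sublevel_subset[of T1] by auto
  qed auto
  define G where "G T = (\<Sum>l\<in>sublevel T1. (wt T l)^2) - v * (\<Sum>l\<in>sublevel T1. c l * wt T l)^2" for T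
  have FG: "F T = G T" if "T0 \<le> T" "T \<le> T1" for T
    using ext[OF that, of 2 "\<lambda>_. 1"] ext[OF that, of 1 c] by (simp add: F_def G_def)
  have "continuous_on {T0..T1} G"
    unfolding G_def wt_def using T0 by (intro continuous_intros) auto
  moreover have "G T1 \<le> 0" "0 \<le> G T0" using F1 F0 FG[of T1] FG[of T0] T1 by auto
  ultimately obtain T where T: "T0 \<le> T" "T \<le> T1" "G T = 0"
    using IVT2'[of G T1 0 T0] T1 by auto
  then have FT: "F T = 0" using FG by simp
  with F0 T have TT: "T0 < T" by (metis less_irrefl order_le_less)
  have "T0^2 < T^2" using TT T0 by (intro power_strict_mono) auto
  then have neT: "sublevel T \<noteq> {}" using l0 by (auto simp: sublevel_def)
  let ?K = "\<Sum>l\<in>sublevel T. c l * wt T l"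
  have K: "0 < ?K"
  proof (rule sum_pos)
    fix l assume "l \<in> sublevel T"
    then show "0 < c l * wt T l"
      using TT T0 by (intro mult_pos_pos wt_pos c_pos) (auto simp: sublevel_def)
  qed (use neT in auto)
  have "critical (1/?K) T (1/?K * (\<Sum>l\<in>sublevel T. wt T l))"
    using K TT T0 by (simp add: critical_def)
  moreover have "(\<Sum>l\<in>sublevel T. (1/?K * wt T l)^2) = v"
  proof -
    have "(\<Sum>l\<in>sublevel T. (1/?K * wt T l)^2) = (\<Sum>l\<in>sublevel T. (wt T l)^2) / ?K^2"
      unfolding sum_divide_distrib by (intro sum.cong refl) (simp only: power_mult_distrib power_divide, simp)
    also have "\<dots> = v" using FT K by (simp add: F_def field_simps)
    finally show ?thesis .
  qed
  ultimately show ?thesis using that TT by blast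
qed

end

section \<open>Optimal weights on the lattice\<close>

definition sqnorm :: "nat set \<Rightarrow> (nat \<Rightarrow> int) \<Rightarrow> int" where
  "sqnorm u l = (\<Sum>j\<in>u. (l j)^2)"

definition level_cost :: "real \<Rightarrow> real \<Rightarrow> real" where
  "level_cost \<sigma> n = (4 * pi^2 * n) powr \<sigma>"

definition signs :: "nat set \<Rightarrow> (nat \<Rightarrow> int) set" where
  "signs u = {l \<in> Zring u. \<forall>j\<in>u. \<bar>l j\<bar> = 1}"

section \<open>Cost levels of the lattice points\<close>

lemma supp_Zring: "l \<in> Zring u \<Longrightarrow> supp l = u"
  by (auto simp: Zring_def supp_def)

lemma csq_Zring: "l \<in> Zring u \<Longrightarrow> csq \<sigma> l = level_cost \<sigma> (of_int (sqnorm u l))"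
  by (simp add: csq_def supp_Zring level_cost_def sqnorm_def sum_distrib_left power_mult_distrib)

lemma sqnorm_ge:
  assumes "l \<in> Zring u" shows "int (card u) \<le> sqnorm u l"
proof -
  have "(\<Sum>j\<in>u. 1) \<le> (\<Sum>j\<in>u. (l j)^2)"
  proof (rule sum_mono)
    fix j assume "j \<in> u"
    then have "l j \<noteq> 0" using assms by (auto simp: Zring_def)
    then have "0 < (l j)^2" by simp
    then show "1 \<le> (l j)^2" by linarith
  qed
  then show ?thesis by (simp add: sqnorm_def)
qed

lemma sqnorm_signs: "l \<in> signs u \<Longrightarrow> sqnorm u l = int (card u)"
proof -
  assume "l \<in> signs u"
  then have "(l j)^2 = 1" if "j \<in> u" for j
    using that by (auto simp: signs_def abs_square_eq_1)
  then show ?thesis by (simp add: sqnorm_def)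
qed

lemma csq_signs: "l \<in> signs u \<Longrightarrow> csq \<sigma> l = level_cost \<sigma> (real (card u))"
  using csq_Zring[of l u \<sigma>] sqnorm_signs[of l u] by (simp add: signs_def)

text \<open>A coordinate of modulus at least 2 contributes at least 4 where a sign contributes 1,
  hence the gap of 3.\<close>

lemma sqnorm_less_signs:
  assumes "finite u" "l \<in> Zring u" "sqnorm u l < int (card u) + 3"
  shows "l \<in> signs u"
proof -
  have "\<bar>l j\<bar> = 1" if j: "j \<in> u" for j
  proof (rule ccontr)
    assume n: "\<bar>l j\<bar> \<noteq> 1"
    have "l j \<noteq> 0" using assms j by (auto simp: Zring_def)
    with n have "2 \<le> \<bar>l j\<bar>" by linarith
    then have 4: "4 \<le> (l j)^2" using power_mono[of 2 "\<bar>l j\<bar>" 2] by simp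
    have "(\<Sum>i\<in>u - {j}. 1) \<le> (\<Sum>i\<in>u - {j}. (l i)^2)"
    proof (rule sum_mono)
      fix i assume "i \<in> u - {j}"
      then have "l i \<noteq> 0" using assms by (auto simp: Zring_def)
      then have "0 < (l i)^2" by simp
      then show "1 \<le> (l i)^2" by linarith
    qed
    then have "int (card u) - 1 \<le> (\<Sum>i\<in>u - {j}. (l i)^2)"
      using j assms(1) by (simp add: of_nat_diff Suc_leI card_gt_0_iff)
    moreover have "sqnorm u l = (l j)^2 + (\<Sum>i\<in>u - {j}. (l i)^2)"
      unfolding sqnorm_def using j assms(1) by (rule sum.remove[rotated])
    ultimately show False using 4 assms(3) by linarith
  qed
  then show ?thesis using assms(2) by (simp add: signs_def)
qed

lemma level_cost_mono:
  "0 < \<sigma> \<Longrightarrow> 0 \<le> m \<Longrightarrow> m < n \<Longrightarrow> level_cost \<sigma> m < level_cost \<sigma> n"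
  unfolding level_cost_def by (intro powr_less_mono2) auto

lemma level_cost_less_iff:
  "0 < \<sigma> \<Longrightarrow> 0 \<le> m \<Longrightarrow> 0 \<le> n \<Longrightarrow> level_cost \<sigma> m < level_cost \<sigma> n \<longleftrightarrow> m < n"
  by (metis level_cost_mono linorder_less_linear order_less_imp_not_less)

lemma level_cost_pos: "0 < n \<Longrightarrow> 0 < level_cost \<sigma> n"
  by (simp add: level_cost_def)

lemma finite_csq_sublevel:
  assumes "0 < \<sigma>" "finite u"
  shows "finite {l \<in> Zring u. csq \<sigma> l < B}"
proof -
  \<comment> \<open>Inverting the power bounds the squared norm and with it every coordinate;
    \<open>max B 0\<close> keeps the base of \<open>powr\<close> nonnegative.\<close>
  obtain K :: nat where K: "(max B 0) powr (1/\<sigma>) < real K" using reals_Archimedean2 by blast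
  have "{l \<in> Zring u. csq \<sigma> l < B} \<subseteq>
    {f. \<forall>x. (x \<in> u \<longrightarrow> f x \<in> {-int K..int K}) \<and> (x \<notin> u \<longrightarrow> f x = 0)}"
  proof (clarsimp, intro conjI impI allI)
    fix l x assume l: "l \<in> Zring u" "csq \<sigma> l < B"
    show "l x = 0" if "x \<notin> u" using l that by (auto simp: Zring_def)
    assume x: "x \<in> u"
    let ?n = "real_of_int (sqnorm u l)"
    have n0: "0 \<le> ?n" by (simp add: sqnorm_def sum_nonneg)
    have "(4 * pi^2 * ?n) powr \<sigma> < max B 0" using l by (simp add: csq_Zring level_cost_def)
    then have "((4 * pi^2 * ?n) powr \<sigma>) powr (1/\<sigma>) < (max B 0) powr (1/\<sigma>)"
      using assms by (intro powr_less_mono2) auto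
    then have "4 * pi^2 * ?n < real K" using K assms n0 by (simp add: powr_powr)
    moreover have "1 * ?n \<le> 4 * pi^2 * ?n"
    proof (rule mult_right_mono[OF _ n0])
      have "2 * 2 \<le> pi * pi" using pi_ge_two by (intro mult_mono) auto
      then show "1 \<le> 4 * pi^2" by (simp add: power2_eq_square)
    qed
    ultimately have "?n < real K" by linarith
    then have "sqnorm u l < int K" by linarith
    moreover have "(l x)^2 \<le> sqnorm u l"
      unfolding sqnorm_def by (rule member_le_sum) (use x assms in auto)
    moreover have "\<bar>l x\<bar> \<le> (l x)^2"
      using self_le_power[of "\<bar>l x\<bar>" 2] by (cases "l x = 0") auto
    ultimately have "\<bar>l x\<bar> \<le> int K" by linarith
    then show "- int K \<le> l x" "l x \<le> int K" by auto
  qed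
  then show ?thesis
    by (rule finite_subset) (rule finite_set_of_finite_funs, use assms in auto)
qed

lemma extremal_problem_Zring:
  assumes "0 < \<sigma>" "finite u" "u \<noteq> {}"
  shows "extremal_problem (Zring u) (csq \<sigma>)"
proof
  fix l assume l: "l \<in> Zring u"
  have "0 < card u" using assms by (simp add: card_gt_0_iff)
  then have "0 < sqnorm u l" using sqnorm_ge[OF l] by linarith
  then show "0 < csq \<sigma> l" using l by (simp add: csq_Zring level_cost_pos)
qed (rule finite_csq_sublevel[OF assms(1,2)])

lemma card_signs:
  assumes "finite u" shows "card (signs u) = 2 ^ card u"
proof -
  have "bij_betw (\<lambda>A j. if j \<in> A then 1 else if j \<in> u then -1 else 0) (Pow u) (signs u)"
  proof (rule bij_betw_byWitness[where f' = "\<lambda>l. {j. l j = 1}"])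
    show "\<forall>l\<in>signs u. (\<lambda>j. if j \<in> {j. l j = 1} then 1 else if j \<in> u then - 1 else 0) = l"
    proof (intro ballI ext)
      fix l j assume l: "l \<in> signs u"
      have "l j = 1 \<or> l j = -1" if "j \<in> u" using l that by (auto simp: signs_def abs_eq_iff')
      moreover have "l j = 0" if "j \<notin> u" using l that by (auto simp: signs_def Zring_def)
      ultimately show "(if j \<in> {j. l j = 1} then 1 else if j \<in> u then - 1 else 0) = l j" by auto
    qed
    show "(\<lambda>l. {j. l j = 1}) ` signs u \<subseteq> Pow u"
      by (force simp: signs_def Zring_def)
    show "(\<lambda>A j. if j \<in> A then 1 else if j \<in> u then - 1 else 0) ` Pow u \<subseteq> signs u"
    proof (rule image_subsetI)
      fix A assume "A \<in> Pow u"
      then show "(\<lambda>j. if j \<in> A then 1 else if j \<in> u then - 1 else 0) \<in> signs u"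
        unfolding signs_def Zring_def by (simp split: if_split) blast
    qed
  qed auto
  from bij_betw_same_card[OF this] show ?thesis by (simp add: card_Pow assms)
qed

lemma infinite_Zring:
  assumes "u \<noteq> {}" shows "infinite (Zring u)"
proof -
  have "inj (\<lambda>n::nat. \<lambda>j. if j \<in> u then int n + 1 else 0)"
    using assms by (auto simp: inj_on_def fun_eq_iff)
  moreover have "range (\<lambda>n::nat. \<lambda>j. if j \<in> u then int n + 1 else 0) \<subseteq> Zring u"
    by (auto simp: Zring_def)
  ultimately show ?thesis by (metis finite_subset range_inj_infinite)
qed

section \<open>Independence of the extremal value from the choice of coordinates\<close>

definition quartic_inf :: "real \<Rightarrow> nat set \<Rightarrow> real \<Rightarrow> ennreal" where
  "quartic_inf \<sigma> u r = (INF \<theta>\<in>Theta_c \<sigma> u r. \<integral>\<^sup>+ l. ennreal ((\<theta> l)^4) \<partial>count_space (Zring u))"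

text \<open>Relabelling coordinates along a bijection of the supports preserves the cost, so a
  feasible point pulls back with the same integrals. This links \<open>asq\<close>, posed over
  \<open>{1..k}\<close>, to weights living on \<open>Zring u\<close>.\<close>

lemma quartic_inf_le_transport:
  assumes "finite u" "finite v" "card u = card v"
  shows "quartic_inf \<sigma> u r \<le> quartic_inf \<sigma> v r"
proof -
  obtain h where h: "bij_betw h v u" using assms finite_same_card_bij by metis
  define g where "g l j = (if j \<in> v then l (h j) else (0::int))" for l j
  define g' where "g' l i = (if i \<in> u then l (the_inv_into v h i) else (0::int))" for l i
  have hi: "the_inv_into v h (h j) = j" if "j \<in> v" for j
    using h that by (auto simp: bij_betw_def the_inv_into_f_f)
  have hi': "h (the_inv_into v h i) = i" "the_inv_into v h i \<in> v" if "i \<in> u" for i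
    using h that by (auto simp: bij_betw_def intro: f_the_inv_into_f the_inv_into_into)
  have hu: "h j \<in> u" if "j \<in> v" for j using h that by (auto simp: bij_betw_def)
  have g: "bij_betw g (Zring u) (Zring v)"
  proof (rule bij_betw_byWitness[where f' = g'])
    show "\<forall>l\<in>Zring u. g' (g l) = l" by (auto simp: g_def g'_def hi' fun_eq_iff Zring_def)
    show "\<forall>l\<in>Zring v. g (g' l) = l" by (auto simp: g_def g'_def hi hu fun_eq_iff Zring_def)
  qed (auto simp: g_def g'_def hi' hu Zring_def)
  have cg: "csq \<sigma> (g l) = csq \<sigma> l" if l: "l \<in> Zring u" for l
  proof -
    have gl: "g l \<in> Zring v" using g l by (auto simp: bij_betw_def)
    have "sqnorm v (g l) = (\<Sum>j\<in>v. (l (h j))^2)" by (simp add: sqnorm_def g_def)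
    also have "\<dots> = sqnorm u l" unfolding sqnorm_def by (rule sum.reindex_bij_betw[OF h])
    finally show ?thesis by (simp add: csq_Zring[OF gl] csq_Zring[OF l])
  qed
  have tr: "(\<integral>\<^sup>+ l. f (g l) \<partial>count_space (Zring u)) = (\<integral>\<^sup>+ l. f l \<partial>count_space (Zring v))" for f
    by (rule nn_integral_bij_count_space[OF g])
  show ?thesis
    unfolding quartic_inf_def
  proof (rule INF_greatest)
    fix \<theta> assume th: "\<theta> \<in> Theta_c \<sigma> v r"
    have "(\<integral>\<^sup>+ l. ennreal ((\<theta> (g l))^2 * csq \<sigma> l) \<partial>count_space (Zring u))
        = (\<integral>\<^sup>+ l. ennreal ((\<theta> (g l))^2 * csq \<sigma> (g l)) \<partial>count_space (Zring u))"
      by (rule nn_integral_cong) (simp add: cg)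
    also have "\<dots> = (\<integral>\<^sup>+ l. ennreal ((\<theta> l)^2 * csq \<sigma> l) \<partial>count_space (Zring v))"
      by (rule tr)
    finally have "(\<lambda>l. \<theta> (g l)) \<in> Theta_c \<sigma> u r"
      using th tr[of "\<lambda>l. ennreal ((\<theta> l)^2)"] by (simp add: Theta_c_def)
    then have "(INF \<theta>\<in>Theta_c \<sigma> u r. \<integral>\<^sup>+ l. ennreal ((\<theta> l)^4) \<partial>count_space (Zring u))
        \<le> (\<integral>\<^sup>+ l. ennreal ((\<theta> (g l))^4) \<partial>count_space (Zring u))" by (rule INF_lower)
    also have "\<dots> = (\<integral>\<^sup>+ l. ennreal ((\<theta> l)^4) \<partial>count_space (Zring v))" by (rule tr)
    finally show "(INF \<theta>\<in>Theta_c \<sigma> u r. \<integral>\<^sup>+ l. ennreal ((\<theta> l)^4) \<partial>count_space (Zring u))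
        \<le> (\<integral>\<^sup>+ l. ennreal ((\<theta> l)^4) \<partial>count_space (Zring v))" .
  qed
qed

lemma quartic_inf_transport:
  assumes "finite u" "finite v" "card u = card v"
  shows "quartic_inf \<sigma> u r = quartic_inf \<sigma> v r"
  using quartic_inf_le_transport assms by (metis antisym)

lemma asq_eq_quartic_inf:
  assumes "finite u" "card u = k" "0 < \<epsilon>"
  shows "asq \<sigma> \<epsilon> k r = quartic_inf \<sigma> u r / ennreal (2 * \<epsilon>^4)"
proof -
  let ?C = "ennreal (2 * \<epsilon>^4)"
  let ?v = "{1..k}"
  let ?f = "\<lambda>\<theta>. \<integral>\<^sup>+ l. ennreal ((\<theta> l)^4) \<partial>count_space (Zring ?v)"
  have C: "?C \<noteq> 0" "?C \<noteq> \<top>" using assms by auto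
  have canc: "x / ?C * ?C = x" for x
  proof -
    have "x / ?C * ?C = ?C * x / ?C" by (simp add: mult.commute ennreal_times_divide)
    then show ?thesis using C by (simp add: mult.commute[of ?C] ennreal_mult_divide_eq)
  qed
  have "asq \<sigma> \<epsilon> k r = quartic_inf \<sigma> ?v r / ?C"
  proof (rule antisym)
    \<comment> \<open>The constant leaves the infimum by multiplying back with \<open>?C\<close>,
      which is neither zero nor infinite.\<close>
    have "asq \<sigma> \<epsilon> k r * ?C \<le> quartic_inf \<sigma> ?v r"
      unfolding quartic_inf_def
    proof (rule INF_greatest)
      fix \<theta> assume "\<theta> \<in> Theta_c \<sigma> ?v r"
      then have "asq \<sigma> \<epsilon> k r \<le> ?f \<theta> / ?C" unfolding asq_def by (rule INF_lower)
      then have "asq \<sigma> \<epsilon> k r * ?C \<le> ?f \<theta> / ?C * ?C" by (rule mult_right_mono) simp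
      then show "asq \<sigma> \<epsilon> k r * ?C \<le> ?f \<theta>" by (simp only: canc)
    qed
    then have "asq \<sigma> \<epsilon> k r * ?C / ?C \<le> quartic_inf \<sigma> ?v r / ?C" by (rule divide_right_mono_ennreal)
    then show "asq \<sigma> \<epsilon> k r \<le> quartic_inf \<sigma> ?v r / ?C"
      using C by (simp add: ennreal_mult_divide_eq)
    show "quartic_inf \<sigma> ?v r / ?C \<le> asq \<sigma> \<epsilon> k r"
      unfolding asq_def quartic_inf_def
      by (intro INF_greatest divide_right_mono_ennreal INF_lower)
  qed
  also have "quartic_inf \<sigma> ?v r = quartic_inf \<sigma> u r"
    by (rule quartic_inf_transport) (use assms in auto)
  finally show ?thesis .
qed

text \<open>Passes between \<open>a_eps\<close> and the bare quartic sum for which the extremal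
  problem is solved. An infinite infimum makes \<open>a_eps\<close> infinite, so it exceeds every
  \<open>A\<close> and equals none.\<close>

lemma a_eps_iff_quartic_inf:
  assumes "finite u" "card u = k" "0 < \<epsilon>" "0 < A"
  shows "(a_eps \<sigma> \<epsilon> k r = ereal A \<longleftrightarrow> quartic_inf \<sigma> u r = ennreal (2 * \<epsilon>^4 * A^2)) \<and>
    (ereal A < a_eps \<sigma> \<epsilon> k r \<longleftrightarrow> ennreal (2 * \<epsilon>^4 * A^2) < quartic_inf \<sigma> u r)"
proof (cases "quartic_inf \<sigma> u r")
  case top
  have "0 < 2 * \<epsilon>^4" using assms by simp
  then have "asq \<sigma> \<epsilon> k r = \<top>"
    by (simp add: asq_eq_quartic_inf[OF assms(1-3)] top ennreal_top_divide)
  then show ?thesis using top by (simp add: a_eps_def)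
next
  case (real q)
  have e: "0 < 2 * \<epsilon>^4" using assms by simp
  have "asq \<sigma> \<epsilon> k r = ennreal (q / (2 * \<epsilon>^4))"
    unfolding asq_eq_quartic_inf[OF assms(1-3)] using e real by (simp add: divide_ennreal)
  then have a: "a_eps \<sigma> \<epsilon> k r = ereal (sqrt (q / (2 * \<epsilon>^4)))"
    using real e by (simp add: a_eps_def)
  have "sqrt (q / (2 * \<epsilon>^4)) = A \<longleftrightarrow> q / (2 * \<epsilon>^4) = A^2"
    using assms(4) by (metis abs_of_pos real_sqrt_abs real_sqrt_eq_iff)
  then have 1: "sqrt (q / (2 * \<epsilon>^4)) = A \<longleftrightarrow> q = 2 * \<epsilon>^4 * A^2" using e by (auto simp: field_simps)
  have "A < sqrt (q / (2 * \<epsilon>^4)) \<longleftrightarrow> A^2 < q / (2 * \<epsilon>^4)"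
    using assms(4) by (metis abs_of_pos real_sqrt_abs real_sqrt_less_iff)
  then have 2: "A < sqrt (q / (2 * \<epsilon>^4)) \<longleftrightarrow> 2 * \<epsilon>^4 * A^2 < q" using e by (auto simp: field_simps)
  have "0 \<le> 2 * \<epsilon>^4 * A^2" by simp
  then show ?thesis unfolding a real(2) using 1 2 real(1) by (simp add: ennreal_inj ennreal_less_iff)
qed

text \<open>The cost takes the value \<open>level_cost \<sigma> k\<close> on the \<open>2 ^ k\<close> sign vectors and at least
  \<open>level_cost \<sigma> (k + 3)\<close> elsewhere; below the bound \<open>small\<close> the extremal cutoff exceeds the second value.\<close>
lemma Zring_critical:
  assumes "0 < \<sigma>" "finite u" "card u = k" "1 \<le> k" "0 < v"
    and small: "v * 2^k * (level_cost \<sigma> (real k))^2 < 1"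
  obtains a T R where "extremal_problem.critical (Zring u) (csq \<sigma>) a T R"
    "(\<Sum>l\<in>extremal_problem.sublevel (Zring u) (csq \<sigma>) T. (a * extremal_problem.wt (csq \<sigma>) T l)^2) = v"
    "level_cost \<sigma> (real k + 3) < T^2"
proof -
  have u: "u \<noteq> {}" using assms by auto
  interpret extremal_problem "Zring u" "csq \<sigma>" by (rule extremal_problem_Zring[OF assms(1,2) u])
  let ?c = "level_cost \<sigma> (real k)" and ?c' = "level_cost \<sigma> (real k + 3)"
  \<comment> \<open>Sublevel sets are strict, so with \<open>T0^2\<close> equal to the next cost
    value only the sign vectors remain.\<close>
  define T0 where "T0 = sqrt ?c'"
  have c: "0 < ?c" "0 < ?c'" "?c < ?c'"
    using assms by (auto intro!: level_cost_pos level_cost_mono)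
  have T0: "0 < T0" "T0^2 = ?c'" using c by (auto simp: T0_def)
  have csign: "csq \<sigma> l = ?c" if "l \<in> signs u" for l
    using csq_signs[OF that] assms(3) by simp
  have sub: "sublevel T0 = signs u"
  proof (intro equalityI subsetI)
    fix l assume l: "l \<in> sublevel T0"
    then have lz: "l \<in> Zring u" by (simp add: sublevel_def)
    have "level_cost \<sigma> (of_int (sqnorm u l)) < ?c'" using l T0 csq_Zring[OF lz] by (simp add: sublevel_def)
    then have "sqnorm u l < int k + 3"
      using assms sqnorm_ge[OF lz] by (subst (asm) level_cost_less_iff) auto
    then show "l \<in> signs u" using sqnorm_less_signs[OF assms(2) lz] assms by simp
  next
    fix l assume "l \<in> signs u"
    then show "l \<in> sublevel T0" using csign[of l] T0 c by (simp add: sublevel_def signs_def)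
  qed
  define w where "w = 1 - ?c / ?c'"
  have w: "0 < w" using c by (simp add: w_def)
  have wt: "wt T0 l = w" if "l \<in> signs u" for l
    using w csign[OF that] T0 by (simp add: wt_def w_def)
  \<comment> \<open>Cost and weight are constant on the sign vectors; after cancelling
    \<open>2^k * w^2\<close> the condition of \<open>critical_exists\<close> is exactly
    \<open>small\<close>.\<close>
  have "v * (\<Sum>l\<in>sublevel T0. csq \<sigma> l * wt T0 l)^2 = v * 2^k * ?c^2 * (2^k * w^2)"
    unfolding sub using assms by (simp add: csign wt card_signs power_mult_distrib power2_eq_square mult_ac)
  also have "\<dots> < 1 * (2^k * w^2)" using small w by (intro mult_strict_right_mono) auto
  also have "\<dots> = (\<Sum>l\<in>sublevel T0. (wt T0 l)^2)"
    unfolding sub using assms by (simp add: wt card_signs)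
  finally have less: "v * (\<Sum>l\<in>sublevel T0. csq \<sigma> l * wt T0 l)^2 < (\<Sum>l\<in>sublevel T0. (wt T0 l)^2)" .
  have "sublevel T0 \<noteq> {}" unfolding sub using card_signs[OF assms(2)] by auto
  then obtain a T R where r: "critical a T R" "T0 < T" "(\<Sum>l\<in>sublevel T. (a * wt T l)^2) = v"
    using critical_exists[OF infinite_Zring[OF u] T0(1) _ assms(5) less] by metis
  moreover have "?c' < T^2" using r(2) T0 by (metis power_strict_mono less_imp_le pos2)
  ultimately show thesis using that by blast
qed

text \<open>Here the definite descriptions are resolved; afterwards the weights are known only
  through these properties. \<open>S\<close> is the sublevel set at the optimal cutoff, and the
  value 1/2 is the unit variance normalisation.\<close>

lemma omega_properties:
  fixes A :: real
  assumes "0 < \<sigma>" "0 < \<epsilon>" "finite u" "card u = k" "1 \<le> k" "0 < A"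
    and small: "2 * \<epsilon>^4 * A^2 * 2^k * (level_cost \<sigma> (real k))^2 < 1"
  defines "rs \<equiv> THE r. r > 0 \<and> a_eps \<sigma> \<epsilon> k r = ereal A"
  shows "\<exists>S. finite S \<and> S \<subseteq> Zring u \<and> (\<forall>l\<in>Zring u - S. omega \<sigma> \<epsilon> k u rs l = 0)
    \<and> (\<Sum>l\<in>S. (omega \<sigma> \<epsilon> k u rs l)^2) = 1/2
    \<and> (\<forall>l\<in>S. 0 \<le> omega \<sigma> \<epsilon> k u rs l \<and> omega \<sigma> \<epsilon> k u rs l \<le> sqrt (1/2^k))
    \<and> (\<forall>r \<theta>. 0 < r \<longrightarrow> ereal A < a_eps \<sigma> \<epsilon> k r \<longrightarrow> \<theta> \<in> Theta_c \<sigma> u r \<longrightarrow>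
         A \<le> (\<Sum>l\<in>S. omega \<sigma> \<epsilon> k u rs l * (\<theta> l / \<epsilon>)^2))"
proof -
  have u: "u \<noteq> {}" using assms by auto
  interpret extremal_problem "Zring u" "csq \<sigma>" by (rule extremal_problem_Zring[OF assms(1,3) u])
  define v where "v = 2 * \<epsilon>^4 * A^2"
  have v: "0 < v" using assms by (simp add: v_def)
  have sm: "v * 2^k * (level_cost \<sigma> (real k))^2 < 1" using small by (simp add: v_def)
  obtain a T R where cr: "critical a T R" and V: "(\<Sum>l\<in>sublevel T. (a * wt T l)^2) = v"
    and T2: "level_cost \<sigma> (real k + 3) < T^2"
    using Zring_critical[OF assms(1,3,4,5) v sm] by metis
  note p = critical_pos[OF cr]
  have fea: "feasible r = Theta_c \<sigma> u r" for r by (simp add: feasible_def Theta_c_def)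
  have opt: "optval r = quartic_inf \<sigma> u r" for r by (simp add: optval_def quartic_inf_def fea)
  note iff = a_eps_iff_quartic_inf[OF assms(3,4,2,6), of \<sigma>, folded opt v_def]
  have sR: "(sqrt R)^2 = R" "0 < sqrt R" using p by auto
  have rs: "rs = sqrt R"
    unfolding rs_def
  proof (rule the_equality)
    show "0 < sqrt R \<and> a_eps \<sigma> \<epsilon> k (sqrt R) = ereal A"
      using iff optval_critical[OF cr sR(1)] V sR by simp
    \<comment> \<open>Any other solution would lie strictly on one side of \<open>sqrt R\<close>,
      where the value is strictly different.\<close>
    fix r assume r: "0 < r \<and> a_eps \<sigma> \<epsilon> k r = ereal A"
    then have o: "optval r = ennreal v" using iff by simp
    have "\<not> r^2 < R" using optval_less[OF cr, of r] r o V by auto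
    moreover have "\<not> R < r^2" using optval_greater[OF cr, of r] r o V by auto
    ultimately have "r^2 = R" by simp
    then show "r = sqrt R" using r by (simp add: real_sqrt_unique)
  qed
  have cost: "csq \<sigma> l = level_cost \<sigma> (real k)" if "l \<in> signs u" for l
    using csq_signs[OF that] assms(4) by simp
  have ck: "level_cost \<sigma> (real k) < level_cost \<sigma> (real k + 3)" using assms by (intro level_cost_mono) auto
  obtain j0 where j0: "j0 \<in> u" using u by blast
  \<comment> \<open>One coordinate 2 and the others 1: the squared norm \<open>k + 3\<close> is
    attained. With a sign vector this supplies the two distinct costs required by
    \<open>critical_unique\<close>.\<close>
  define l2 where "l2 j = (if j = j0 then 2 else if j \<in> u then 1 else (0::int))" for j
  have l2: "l2 \<in> Zring u" using j0 by (auto simp: l2_def Zring_def)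
  have "sqnorm u l2 = (l2 j0)^2 + (\<Sum>i\<in>u - {j0}. (l2 i)^2)"
    unfolding sqnorm_def using j0 assms(3) by (rule sum.remove[rotated])
  also have "(\<Sum>i\<in>u - {j0}. (l2 i)^2) = (\<Sum>i\<in>u - {j0}. 1)"
    by (rule sum.cong) (auto simp: l2_def)
  also have "\<dots> = int k - 1" using assms(3-5) j0 by (simp add: of_nat_diff)
  also have "(l2 j0)^2 = 4" by (simp add: l2_def)
  finally have "sqnorm u l2 = int k + 3" by simp
  then have c2: "csq \<sigma> l2 = level_cost \<sigma> (real k + 3)" by (simp add: csq_Zring[OF l2])
  obtain l1 where l1: "l1 \<in> signs u" using card_signs[OF assms(3)] by fastforce
  have l1': "l1 \<in> sublevel T" using l1 cost[OF l1] ck T2 by (simp add: sublevel_def signs_def)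
  have l2': "l2 \<in> sublevel T" using l2 c2 T2 by (simp add: sublevel_def)
  have ne: "csq \<sigma> l1 \<noteq> csq \<sigma> l2" using cost[OF l1] c2 ck by simp
  have th: "thstar_sq \<sigma> u rs l = a * wt T l" for l
  proof -
    have crs: "critical a T (rs^2)" using cr rs sR by simp
    have "(THE p. fst p > 0 \<and> snd p > 0 \<and>
          (\<integral>\<^sup>+ l. ennreal (fst p * max 0 (1 - csq \<sigma> l / (snd p)^2)) \<partial>count_space (Zring u)) = ennreal (rs^2) \<and>
          (\<integral>\<^sup>+ l. ennreal (csq \<sigma> l * (fst p * max 0 (1 - csq \<sigma> l / (snd p)^2))) \<partial>count_space (Zring u)) = 1) = (a, T)"
    proof (rule the_equality, goal_cases)
      case 1
      show ?case using crs p critical_iff[of a T "rs^2"] by simp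
    next
      case (2 q)
      then have "critical (fst q) (snd q) (rs^2)" using critical_iff[of "fst q" "snd q" "rs^2"] by simp
      from critical_unique[OF crs this l1' l2' ne] show ?case by (simp add: prod_eq_iff)
    qed
    then show ?thesis by (simp add: thstar_sq_def wt_def)
  qed
  have aA: "a_eps \<sigma> \<epsilon> k rs = ereal A"
    using iff optval_critical[OF cr sR(1)] V sR rs by simp
  have om: "omega \<sigma> \<epsilon> k u rs l = a * wt T l / (2 * \<epsilon>^2 * A)" for l
    by (simp add: omega_def th aA)
  have eA: "\<epsilon> \<noteq> 0" "A \<noteq> 0" using assms(2,6) by auto
  have den: "0 < 2 * \<epsilon>^2 * A" using assms by simp
  have half: "(\<Sum>l\<in>sublevel T. (omega \<sigma> \<epsilon> k u rs l)^2) = 1/2"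
  proof -
    have "(\<Sum>l\<in>sublevel T. (omega \<sigma> \<epsilon> k u rs l)^2) = v / (2 * \<epsilon>^2 * A)^2"
      unfolding om V[symmetric] by (simp only: power_divide sum_divide_distrib)
    also have "\<dots> = 1/2" using eA by (simp add: v_def field_simps power2_eq_square eval_nat_numeral)
    finally show ?thesis .
  qed
  have nn: "0 \<le> omega \<sigma> \<epsilon> k u rs l" for l using p den by (simp add: om)
  have up: "omega \<sigma> \<epsilon> k u rs l \<le> sqrt (1/2^k)" if l: "l \<in> Zring u" for l
  proof -
    have "real k \<le> of_int (sqnorm u l)" using sqnorm_ge[OF l] assms by linarith
    then have "level_cost \<sigma> (real k) \<le> csq \<sigma> l"
      using level_cost_mono[of \<sigma> "real k" "of_int (sqnorm u l)"] assms(1)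
      by (cases "real k = of_int (sqnorm u l)") (auto simp: csq_Zring[OF l])
    then have "level_cost \<sigma> (real k) / T^2 \<le> csq \<sigma> l / T^2" by (rule divide_right_mono) simp
    then have le: "omega \<sigma> \<epsilon> k u rs l \<le> omega \<sigma> \<epsilon> k u rs l'" if "l' \<in> signs u" for l'
      unfolding om wt_def cost[OF that] using p den
      by (intro divide_right_mono mult_left_mono) auto
    have "2^k * (omega \<sigma> \<epsilon> k u rs l)^2 = (\<Sum>l'\<in>signs u. (omega \<sigma> \<epsilon> k u rs l)^2)"
      using assms by (simp add: card_signs)
    also have "\<dots> \<le> (\<Sum>l'\<in>signs u. (omega \<sigma> \<epsilon> k u rs l')^2)"
      by (intro sum_mono power_mono le nn)
    also have "\<dots> \<le> (\<Sum>l\<in>sublevel T. (omega \<sigma> \<epsilon> k u rs l)^2)"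
    proof (rule sum_mono2[OF finite_sub])
      show "signs u \<subseteq> sublevel T"
      proof
        fix l assume "l \<in> signs u"
        then show "l \<in> sublevel T" using cost[of l] ck T2 by (simp add: sublevel_def signs_def)
      qed
    qed simp
    finally have "(omega \<sigma> \<epsilon> k u rs l)^2 \<le> 1 / 2^k" unfolding half by (simp add: field_simps)
    then show ?thesis by (rule real_le_rsqrt)
  qed
  have mean: "A \<le> (\<Sum>l\<in>sublevel T. omega \<sigma> \<epsilon> k u rs l * (\<theta> l / \<epsilon>)^2)"
    if r: "0 < r" "ereal A < a_eps \<sigma> \<epsilon> k r" and t: "\<theta> \<in> Theta_c \<sigma> u r" for r \<theta>
  proof -
    \<comment> \<open>A value above \<open>v\<close> forces \<open>r^2 \<ge> R\<close>, so the
      variational bound is at least its value \<open>v\<close> at the critical point. Dividing by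
      \<open>2 * \<epsilon>^4 * A\<close> turns \<open>v\<close> into \<open>A\<close>.\<close>
    have "ennreal v < optval r" using iff r by simp
    then have "\<not> r^2 < R" using optval_less[OF cr, of r] r V by auto
    then have "a * (R - 1/T^2) \<le> a * (r^2 - 1/T^2)" using p by (intro mult_left_mono) auto
    then have "v \<le> (\<Sum>l\<in>sublevel T. a * wt T l * (\<theta> l)^2)"
      using critical_variational[OF cr t[folded fea]] critical_sum_squares[OF cr] V by linarith
    then have "v / (2 * \<epsilon>^2 * A * \<epsilon>^2) \<le> (\<Sum>l\<in>sublevel T. a * wt T l * (\<theta> l)^2) / (2 * \<epsilon>^2 * A * \<epsilon>^2)"
      using den by (intro divide_right_mono) auto
    also have "v / (2 * \<epsilon>^2 * A * \<epsilon>^2) = A"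
      using eA by (simp add: v_def power2_eq_square eval_nat_numeral)
    also have "(\<Sum>l\<in>sublevel T. a * wt T l * (\<theta> l)^2) / (2 * \<epsilon>^2 * A * \<epsilon>^2)
        = (\<Sum>l\<in>sublevel T. omega \<sigma> \<epsilon> k u rs l * (\<theta> l / \<epsilon>)^2)"
      by (simp add: om sum_divide_distrib power_divide)
    finally show ?thesis .
  qed
  have out: "\<forall>l\<in>Zring u - sublevel T. omega \<sigma> \<epsilon> k u rs l = 0"
    using wt_outside[OF p(2)] by (simp add: om)
  have bd: "\<forall>l\<in>sublevel T. 0 \<le> omega \<sigma> \<epsilon> k u rs l \<and> omega \<sigma> \<epsilon> k u rs l \<le> sqrt (1/2^k)"
    using nn up sublevel_subset by blast
  show ?thesis
    by (intro exI[of _ "sublevel T"] conjI finite_sub sublevel_subset out bd half allI impI mean)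
qed

section \<open>Gaussian tail bounds\<close>

lemma ln_one_plus_ge:
  fixes y :: real assumes "0 \<le> y" shows "y - y^2/2 \<le> ln (1 + y)"
proof -
  let ?f = "\<lambda>x. ln (1 + x) - x + x^2/2"
  have "?f 0 \<le> ?f y"
  proof (rule DERIV_nonneg_imp_nondecreasing[OF assms])
    fix x :: real assume x: "0 \<le> x" "x \<le> y"
    then have "(?f has_real_derivative (1 / (1 + x) - 1 + x)) (at x)"
      by (auto intro!: derivative_eq_intros simp: field_simps)
    moreover have "1 / (1 + x) - 1 + x = x^2 / (1 + x)"
      using x by (simp add: field_simps power2_eq_square)
    ultimately show "\<exists>D. (?f has_real_derivative D) (at x) \<and> 0 \<le> D" using x by force
  qed
  then show ?thesis by simp
qed

text \<open>The cubic coefficient 1 is larger than the Taylor value 1/3, which makes the derivative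
  of the difference \<open>x^2 * (2 - 3 * x) / (1 - x)\<close>, nonnegative on the range.\<close>

lemma ln_one_minus_ge:
  fixes y :: real assumes "0 \<le> y" "y \<le> 1/2" shows "- y - y^2/2 - y^3 \<le> ln (1 - y)"
proof -
  let ?f = "\<lambda>x. ln (1 - x) + x + x^2/2 + x^3"
  have "?f 0 \<le> ?f y"
  proof (rule DERIV_nonneg_imp_nondecreasing[OF assms(1)])
    fix x :: real assume x: "0 \<le> x" "x \<le> y"
    have x1: "x < 1" using x assms by linarith
    have "(?f has_real_derivative (- 1 / (1 - x) + 1 + x + 3 * x^2)) (at x)"
      using x1 by (auto intro!: derivative_eq_intros)
    moreover have "- 1 / (1 - x) + 1 + x + 3 * x^2 = x^2 * (2 - 3 * x) / (1 - x)"
    proof -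
      have "x^2 * (2 - 3 * x) = - 1 + (1 + x + 3 * x^2) * (1 - x)"
        by (simp add: power2_eq_square algebra_simps)
      then have "x^2 * (2 - 3 * x) / (1 - x) = - 1 / (1 - x) + (1 + x + 3 * x^2) * (1 - x) / (1 - x)"
        by (simp only: add_divide_distrib)
      also have "(1 + x + 3 * x^2) * (1 - x) / (1 - x) = 1 + x + 3 * x^2" using x1 by simp
      finally show ?thesis by simp
    qed
    moreover have "0 \<le> x^2 * (2 - 3 * x) / (1 - x)" using x assms x1 by simp
    ultimately show "\<exists>D. (?f has_real_derivative D) (at x) \<and> 0 \<le> D" by (intro exI conjI) simp_all
  qed
  then show ?thesis by simp
qed

text \<open>The left side is the moment generating function at \<open>s\<close> of a centred squared
  standard normal. The exponent \<open>s^2\<close> is that of a normal variable of variance 2;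
  \<open>4 * s^3\<close> is the price of the heavier upper tail.\<close>

lemma upper_factor_bound:
  fixes s :: real assumes "0 \<le> s" "s \<le> 1/4"
  shows "exp (- s) / sqrt (1 - 2 * s) \<le> exp (s^2 * (1 + 4 * s))"
proof -
  have "- (2 * s) - (2 * s)^2/2 - (2 * s)^3 \<le> ln (1 - 2 * s)"
    by (rule ln_one_minus_ge) (use assms in auto)
  then have "- s - s^2 * (1 + 4 * s) \<le> ln (1 - 2 * s) / 2"
    by (simp add: power2_eq_square eval_nat_numeral algebra_simps)
  then have "exp (- s - s^2 * (1 + 4 * s)) \<le> exp (ln (1 - 2 * s) / 2)" by simp
  also have "\<dots> = sqrt (1 - 2 * s)" using assms by (simp add: ln_sqrt[symmetric])
  finally have "exp (- s) \<le> exp (s^2 * (1 + 4 * s)) * sqrt (1 - 2 * s)"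
    by (simp add: exp_diff field_simps)
  then show ?thesis using assms by (simp add: field_simps)
qed

text \<open>The same moment generating function at \<open>- x\<close>: towards the lower tail the
  normal bound holds without correction.\<close>

lemma lower_factor_bound:
  fixes x :: real assumes "0 \<le> x"
  shows "exp x / sqrt (1 + 2 * x) \<le> exp (x^2)"
proof -
  have "2 * x - (2 * x)^2/2 \<le> ln (1 + 2 * x)"
    by (rule ln_one_plus_ge) (use assms in auto)
  then have "x - x^2 \<le> ln (1 + 2 * x) / 2"
    by (simp add: power2_eq_square eval_nat_numeral algebra_simps)
  then have "exp (x - x^2) \<le> exp (ln (1 + 2 * x) / 2)" by simp
  also have "\<dots> = sqrt (1 + 2 * x)" using assms by (simp add: ln_sqrt[symmetric])
  finally have "exp x \<le> exp (x^2) * sqrt (1 + 2 * x)"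
    by (simp add: exp_diff field_simps)
  then show ?thesis using assms by (simp add: field_simps)
qed

section \<open>Exponential moments of a shifted squared normal variable\<close>

lemma nn_integral_normal_density:
  assumes "0 < \<tau>" shows "(\<integral>\<^sup>+ x. ennreal (normal_density \<mu> \<tau> x) \<partial>lborel) = 1"
proof -
  interpret prob_space "density lborel (\<lambda>x. ennreal (normal_density \<mu> \<tau> x))"
    by (rule prob_space_normal_density[OF assms])
  show ?thesis using emeasure_space_1 by (simp add: emeasure_density)
qed

text \<open>Completing the square turns the integrand into a multiple of another normal density.\<close>
lemma nn_integral_exp_shifted_square:
  assumes s: "s < 1/2"
  shows "(\<integral>\<^sup>+ x. ennreal (exp (s * (x + v)^2)) \<partial>std_normal_distribution)
    = ennreal (exp (s * v^2 / (1 - 2 * s)) / sqrt (1 - 2 * s))"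
proof -
  define q where "q = 1 - 2 * s"
  define \<tau> where "\<tau> = 1 / sqrt q"
  define \<mu> where "\<mu> = 2 * s * v / q"
  define C where "C = exp (s * v^2 / q) / sqrt q"
  have q: "0 < q" using s by (simp add: q_def)
  have \<tau>: "0 < \<tau>" "\<tau>^2 = 1 / q" using q by (auto simp: \<tau>_def power_divide)
  have C: "0 < C" using q by (simp add: C_def)
  have eq: "std_normal_density x * exp (s * (x + v)^2) = C * normal_density \<mu> \<tau> x" for x
  proof -
    have s': "s = (1 - q) / 2" by (simp add: q_def)
    have e: "-(x^2) / 2 + s * (x + v)^2 = s * v^2 / q + (- ((x - \<mu>)^2) / (2 * \<tau>^2))"
      unfolding \<tau>(2) \<mu>_def s' using q by (simp add: divide_simps) (simp add: power2_eq_square algebra_simps)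
    have "normal_density \<mu> \<tau> x = 1 / sqrt (2 * pi / q) * exp (- ((x - \<mu>)^2) / (2 * \<tau>^2))"
      by (simp add: normal_density_def \<tau>)
    then have "C * normal_density \<mu> \<tau> x = (1 / sqrt (2 * pi)) * (exp (s * v^2 / q) * exp (- ((x - \<mu>)^2) / (2 * \<tau>^2)))"
      using q by (simp add: C_def real_sqrt_divide)
    also have "\<dots> = (1 / sqrt (2 * pi)) * (exp (- (x^2) / 2) * exp (s * (x + v)^2))"
      unfolding exp_add[symmetric] e ..
    finally show ?thesis by (simp add: normal_density_def)
  qed
  have "(\<integral>\<^sup>+ x. ennreal (exp (s * (x + v)^2)) \<partial>std_normal_distribution)
      = (\<integral>\<^sup>+ x. ennreal (std_normal_density x) * ennreal (exp (s * (x + v)^2)) \<partial>lborel)"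
    by (rule nn_integral_density) auto
  also have "\<dots> = (\<integral>\<^sup>+ x. ennreal C * ennreal (normal_density \<mu> \<tau> x) \<partial>lborel)"
  proof (rule nn_integral_cong)
    fix x
    have "ennreal (std_normal_density x) * ennreal (exp (s * (x + v)^2))
        = ennreal (std_normal_density x * exp (s * (x + v)^2))" by (subst ennreal_mult) auto
    also have "\<dots> = ennreal C * ennreal (normal_density \<mu> \<tau> x)"
      unfolding eq using C by (subst ennreal_mult) auto
    finally show "ennreal (std_normal_density x) * ennreal (exp (s * (x + v)^2))
        = ennreal C * ennreal (normal_density \<mu> \<tau> x)" .
  qed
  also have "\<dots> = ennreal C"
    by (simp add: nn_integral_cmult nn_integral_normal_density[OF \<tau>(1)])
  finally show ?thesis by (simp add: C_def q_def)
qed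

section \<open>The noise measure and Chernoff bounds\<close>

lemma product_prob_space_std_normal: "product_prob_space (\<lambda>_. std_normal_distribution)"
proof -
  interpret prob_space std_normal_distribution by (rule prob_space_normal_density) simp
  show ?thesis by unfold_locales
qed

lemma prob_space_noise: "prob_space (noise d k)"
proof -
  interpret product_prob_space "\<lambda>_. std_normal_distribution" "index_set d k"
    by (rule product_prob_space_std_normal)
  show ?thesis unfolding noise_def by (rule prob_space_PiM) (rule prob_space_normal_density, simp)
qed

lemma measurable_noise_coordinate:
  "l \<in> index_set d k \<Longrightarrow> (\<lambda>\<xi>. \<xi> l) \<in> borel_measurable (noise d k)"
  unfolding noise_def using measurable_component_singleton[of l "index_set d k" "\<lambda>_. std_normal_distribution"]
  by simp

text \<open>\<open>noise\<close> may be an infinite product; restriction to the finite set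
  \<open>S\<close> has the finite product as its law, where integrals of products factorise.\<close>

lemma nn_integral_noise_prod:
  assumes S: "finite S" "S \<subseteq> index_set d k" and f: "\<And>l. l \<in> S \<Longrightarrow> f l \<in> borel_measurable borel"
  shows "(\<integral>\<^sup>+ \<xi>. (\<Prod>l\<in>S. f l (\<xi> l)) \<partial>noise d k) = (\<Prod>l\<in>S. \<integral>\<^sup>+ x. f l x \<partial>std_normal_distribution)"
proof -
  interpret product_prob_space "\<lambda>_. std_normal_distribution" "index_set d k"
    by (rule product_prob_space_std_normal)
  let ?N = "\<lambda>_::nat \<Rightarrow> int. std_normal_distribution"
  have f': "f l \<in> borel_measurable std_normal_distribution" if "l \<in> S" for l
    using f[OF that] by simp
  have m: "(\<lambda>x. \<Prod>l\<in>S. f l (x l)) \<in> borel_measurable (PiM S ?N)"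
  proof (intro borel_measurable_prod_ennreal)
    fix l assume l: "l \<in> S"
    show "(\<lambda>x. f l (x l)) \<in> borel_measurable (PiM S ?N)"
      by (rule measurable_compose[of "\<lambda>x. x l", OF _ f'[OF l]])
        (rule measurable_component_singleton[OF l, of ?N])
  qed
  have "(\<Prod>l\<in>S. \<integral>\<^sup>+ x. f l x \<partial>std_normal_distribution) = (\<integral>\<^sup>+ x. (\<Prod>l\<in>S. f l (x l)) \<partial>PiM S ?N)"
    by (rule product_nn_integral_prod[symmetric]) (use S f' in auto)
  also have "\<dots> = (\<integral>\<^sup>+ x. (\<Prod>l\<in>S. f l (x l)) \<partial>distr (noise d k) (PiM S ?N) (\<lambda>x. restrict x S))"
    unfolding noise_def using distr_PiM_restrict_finite[OF S] by simp
  also have "\<dots> = (\<integral>\<^sup>+ x. (\<Prod>l\<in>S. f l (restrict x S l)) \<partial>noise d k)"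
    by (rule nn_integral_distr) (use m S in \<open>auto simp: noise_def intro!: measurable_restrict_subset\<close>)
  also have "\<dots> = (\<integral>\<^sup>+ x. (\<Prod>l\<in>S. f l (x l)) \<partial>noise d k)"
    by (intro nn_integral_cong prod.cong) auto
  finally show ?thesis by simp
qed

text \<open>Keeping \<open>\<kappa>\<close> on both sides of the event covers both tails: a positive
  value gives the upper tail, a negative one the lower tail.\<close>

lemma noise_chernoff:
  assumes S: "finite S" "S \<subseteq> index_set d k" and s: "\<And>l. l \<in> S \<Longrightarrow> \<kappa> * w l < 1/2"
  shows "measure (noise d k) {\<xi>\<in>space (noise d k). \<kappa> * t \<le> \<kappa> * (\<Sum>l\<in>S. w l * ((\<xi> l + v l)^2 - 1))}
    \<le> exp (- (\<kappa> * t)) * (\<Prod>l\<in>S. exp (- (\<kappa> * w l)) *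
        (exp (\<kappa> * w l * (v l)^2 / (1 - 2 * (\<kappa> * w l))) / sqrt (1 - 2 * (\<kappa> * w l))))"
    (is "measure ?P {\<xi>\<in>_. _ \<le> \<kappa> * ?Q \<xi>} \<le> exp _ * (\<Prod>l\<in>S. ?F l)")
proof -
  interpret prob_space ?P by (rule prob_space_noise)
  have [measurable]: "(\<lambda>\<xi>. \<xi> l) \<in> borel_measurable ?P" if "l \<in> S" for l
    using that S measurable_noise_coordinate by blast
  have [measurable]: "?Q \<in> borel_measurable ?P" by measurable
  have F0: "0 \<le> ?F l" if "l \<in> S" for l using s[OF that] by simp
  have "emeasure ?P {\<xi>\<in>space ?P. \<kappa> * t \<le> \<kappa> * ?Q \<xi>}
      = (\<integral>\<^sup>+ \<xi>. indicator {\<xi>\<in>space ?P. \<kappa> * t \<le> \<kappa> * ?Q \<xi>} \<xi> \<partial>?P)" by simp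
  \<comment> \<open>Markov's inequality in exponential form: the indicator is at most the
    exponential of the difference of the two sides, which factorises over \<open>S\<close>.\<close>
  also have "\<dots> \<le> (\<integral>\<^sup>+ \<xi>. ennreal (exp (- (\<kappa> * t))) * (\<Prod>l\<in>S. ennreal (exp (- (\<kappa> * w l)) * exp (\<kappa> * w l * (\<xi> l + v l)^2))) \<partial>?P)"
  proof (rule nn_integral_mono)
    fix \<xi> 
    have "(\<Prod>l\<in>S. exp (- (\<kappa> * w l)) * exp (\<kappa> * w l * (\<xi> l + v l)^2))
        = exp (\<Sum>l\<in>S. - (\<kappa> * w l) + \<kappa> * w l * (\<xi> l + v l)^2)"
      by (simp only: exp_add[symmetric] exp_sum[OF S(1)])
    also have "(\<Sum>l\<in>S. - (\<kappa> * w l) + \<kappa> * w l * (\<xi> l + v l)^2) = \<kappa> * ?Q \<xi>"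
      by (simp add: sum_distrib_left right_diff_distrib mult.assoc)
    finally have pr: "(\<Prod>l\<in>S. exp (- (\<kappa> * w l)) * exp (\<kappa> * w l * (\<xi> l + v l)^2)) = exp (\<kappa> * ?Q \<xi>)" .
    have "ennreal (exp (- (\<kappa> * t))) * (\<Prod>l\<in>S. ennreal (exp (- (\<kappa> * w l)) * exp (\<kappa> * w l * (\<xi> l + v l)^2)))
        = ennreal (exp (- (\<kappa> * t)) * exp (\<kappa> * ?Q \<xi>))"
      by (subst prod_ennreal) (simp_all add: pr ennreal_mult)
    also have "exp (- (\<kappa> * t)) * exp (\<kappa> * ?Q \<xi>) = exp (\<kappa> * ?Q \<xi> - \<kappa> * t)"
      by (simp add: exp_add[symmetric])
    finally have "ennreal (exp (- (\<kappa> * t))) * (\<Prod>l\<in>S. ennreal (exp (- (\<kappa> * w l)) * exp (\<kappa> * w l * (\<xi> l + v l)^2)))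
        = ennreal (exp (\<kappa> * ?Q \<xi> - \<kappa> * t))" .
    then show "indicator {\<xi>\<in>space ?P. \<kappa> * t \<le> \<kappa> * ?Q \<xi>} \<xi>
        \<le> ennreal (exp (- (\<kappa> * t))) * (\<Prod>l\<in>S. ennreal (exp (- (\<kappa> * w l)) * exp (\<kappa> * w l * (\<xi> l + v l)^2)))"
      by (auto simp: indicator_def ennreal_1[symmetric] simp del: ennreal_1 intro!: ennreal_leI)
  qed
  also have "\<dots> = ennreal (exp (- (\<kappa> * t))) * (\<integral>\<^sup>+ \<xi>. (\<Prod>l\<in>S. ennreal (exp (- (\<kappa> * w l)) * exp (\<kappa> * w l * (\<xi> l + v l)^2))) \<partial>?P)"
    by (rule nn_integral_cmult) measurable
  also have "(\<integral>\<^sup>+ \<xi>. (\<Prod>l\<in>S. ennreal (exp (- (\<kappa> * w l)) * exp (\<kappa> * w l * (\<xi> l + v l)^2))) \<partial>?P)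
      = (\<Prod>l\<in>S. \<integral>\<^sup>+ x. ennreal (exp (- (\<kappa> * w l)) * exp (\<kappa> * w l * (x + v l)^2)) \<partial>std_normal_distribution)"
    by (rule nn_integral_noise_prod[OF S]) measurable
  also have "\<dots> = (\<Prod>l\<in>S. ennreal (?F l))"
  proof (rule prod.cong[OF refl])
    fix l assume "l \<in> S"
    then have s': "\<kappa> * w l < 1/2" by (rule s)
    have "(\<integral>\<^sup>+ x. ennreal (exp (- (\<kappa> * w l)) * exp (\<kappa> * w l * (x + v l)^2)) \<partial>std_normal_distribution)
      = ennreal (exp (- (\<kappa> * w l))) * (\<integral>\<^sup>+ x. ennreal (exp (\<kappa> * w l * (x + v l)^2)) \<partial>std_normal_distribution)"
      by (simp add: ennreal_mult nn_integral_cmult)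
    also have "\<dots> = ennreal (?F l)"
      unfolding nn_integral_exp_shifted_square[OF s'] using s' by (subst ennreal_mult) auto
    finally show "(\<integral>\<^sup>+ x. ennreal (exp (- (\<kappa> * w l)) * exp (\<kappa> * w l * (x + v l)^2)) \<partial>std_normal_distribution) = ennreal (?F l)" .
  qed
  also have "\<dots> = ennreal (\<Prod>l\<in>S. ?F l)" by (rule prod_ennreal) (rule F0)
  finally have "emeasure ?P {\<xi>\<in>space ?P. \<kappa> * t \<le> \<kappa> * ?Q \<xi>} \<le> ennreal (exp (- (\<kappa> * t)) * (\<Prod>l\<in>S. ?F l))"
    using F0 by (simp add: ennreal_mult prod_nonneg)
  then show ?thesis
    unfolding emeasure_eq_measure
    by (subst (asm) ennreal_le_iff) (intro mult_nonneg_nonneg prod_nonneg ballI F0 exp_ge_zero, auto)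
qed

text \<open>Each factor is at most
  \<open>exp (\<kappa>^2 * (1 + 4 * \<kappa> * W) * (w l)^2)\<close>, and the squared weights sum to
  1/2. Thus the exponent is that of N(0, 1) up to the factor with \<open>W\<close>.\<close>

lemma noise_upper_tail:
  assumes S: "finite S" "S \<subseteq> index_set d k" and \<kappa>: "0 \<le> \<kappa>" "\<kappa> * W \<le> 1/4"
    and w: "\<And>l. l \<in> S \<Longrightarrow> 0 \<le> w l \<and> w l \<le> W" and half: "(\<Sum>l\<in>S. (w l)^2) = 1/2"
  shows "measure (noise d k) {\<xi>\<in>space (noise d k). t < (\<Sum>l\<in>S. w l * ((\<xi> l)^2 - 1))}
    \<le> exp (- \<kappa> * t + \<kappa>^2 / 2 * (1 + 4 * \<kappa> * W))"
proof -
  interpret prob_space "noise d k" by (rule prob_space_noise)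
  have [measurable]: "(\<lambda>\<xi>. \<xi> l) \<in> borel_measurable (noise d k)" if "l \<in> S" for l
    using that S measurable_noise_coordinate by blast
  have lw: "0 \<le> \<kappa> * w l" "\<kappa> * w l \<le> \<kappa> * W" if "l \<in> S" for l
    using \<kappa> w[OF that] by (auto intro!: mult_left_mono)
  have "measure (noise d k) {\<xi>\<in>space (noise d k). t < (\<Sum>l\<in>S. w l * ((\<xi> l)^2 - 1))}
      \<le> measure (noise d k) {\<xi>\<in>space (noise d k). \<kappa> * t \<le> \<kappa> * (\<Sum>l\<in>S. w l * ((\<xi> l + 0)^2 - 1))}"
    by (rule finite_measure_mono) (use \<kappa> in \<open>auto intro!: mult_left_mono\<close>)
  also have "\<dots> \<le> exp (- (\<kappa> * t)) * (\<Prod>l\<in>S. exp (- (\<kappa> * w l)) *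
        (exp (\<kappa> * w l * 0^2 / (1 - 2 * (\<kappa> * w l))) / sqrt (1 - 2 * (\<kappa> * w l))))"
    by (rule noise_chernoff[OF S]) (use lw \<kappa> in fastforce)
  also have "\<dots> \<le> exp (- (\<kappa> * t)) * (\<Prod>l\<in>S. exp (\<kappa>^2 * (1 + 4 * \<kappa> * W) * (w l)^2))"
  proof (intro mult_left_mono prod_mono conjI)
    fix l assume l: "l \<in> S"
    have "exp (- (\<kappa> * w l)) / sqrt (1 - 2 * (\<kappa> * w l)) \<le> exp ((\<kappa> * w l)^2 * (1 + 4 * (\<kappa> * w l)))"
      by (rule upper_factor_bound) (use lw[OF l] \<kappa> in auto)
    also have "\<dots> \<le> exp ((\<kappa> * w l)^2 * (1 + 4 * (\<kappa> * W)))"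
      using lw[OF l] by (auto intro!: mult_left_mono)
    also have "(\<kappa> * w l)^2 * (1 + 4 * (\<kappa> * W)) = \<kappa>^2 * (1 + 4 * \<kappa> * W) * (w l)^2"
      by (simp add: power_mult_distrib)
    finally show "exp (- (\<kappa> * w l)) * (exp (\<kappa> * w l * 0^2 / (1 - 2 * (\<kappa> * w l))) / sqrt (1 - 2 * (\<kappa> * w l)))
        \<le> exp (\<kappa>^2 * (1 + 4 * \<kappa> * W) * (w l)^2)" by simp
    show "0 \<le> exp (- (\<kappa> * w l)) * (exp (\<kappa> * w l * 0^2 / (1 - 2 * (\<kappa> * w l))) / sqrt (1 - 2 * (\<kappa> * w l)))"
      using lw[OF l] \<kappa> by (intro mult_nonneg_nonneg divide_nonneg_nonneg) auto
  qed simp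
  also have "(\<Prod>l\<in>S. exp (\<kappa>^2 * (1 + 4 * \<kappa> * W) * (w l)^2)) = exp (\<kappa>^2 * (1 + 4 * \<kappa> * W) * (1/2))"
    unfolding half[symmetric] sum_distrib_left using S by (simp add: exp_sum)
  finally show ?thesis by (simp add: exp_add[symmetric])
qed

text \<open>A shift \<open>v l\<close> contributes
  \<open>- \<kappa> * w l * (v l)^2 / (1 + 2 * \<kappa> * w l)\<close> to the exponent. Replacing
  each denominator by the largest one lets the mean enter only through \<open>A\<close>.\<close>

lemma noise_lower_tail:
  assumes S: "finite S" "S \<subseteq> index_set d k" and \<kappa>: "0 \<le> \<kappa>"
    and w: "\<And>l. l \<in> S \<Longrightarrow> 0 \<le> w l \<and> w l \<le> W" and half: "(\<Sum>l\<in>S. (w l)^2) = 1/2"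
    and W: "0 \<le> W" and A: "A \<le> (\<Sum>l\<in>S. w l * (v l)^2)"
  shows "measure (noise d k) {\<xi>\<in>space (noise d k). (\<Sum>l\<in>S. w l * ((\<xi> l + v l)^2 - 1)) \<le> t}
    \<le> exp (\<kappa> * t + \<kappa>^2 / 2 - \<kappa> * A / (1 + 2 * \<kappa> * W))"
proof -
  interpret prob_space "noise d k" by (rule prob_space_noise)
  have [measurable]: "(\<lambda>\<xi>. \<xi> l) \<in> borel_measurable (noise d k)" if "l \<in> S" for l
    using that S measurable_noise_coordinate by blast
  have lw: "0 \<le> \<kappa> * w l" "\<kappa> * w l \<le> \<kappa> * W" if "l \<in> S" for l
    using \<kappa> w[OF that] by (auto intro!: mult_left_mono)
  let ?D = "1 + 2 * \<kappa> * W"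
  have D: "0 < ?D" using \<kappa> W by (simp add: add_pos_nonneg)
  have "measure (noise d k) {\<xi>\<in>space (noise d k). (\<Sum>l\<in>S. w l * ((\<xi> l + v l)^2 - 1)) \<le> t}
      \<le> measure (noise d k) {\<xi>\<in>space (noise d k). (- \<kappa>) * t \<le> (- \<kappa>) * (\<Sum>l\<in>S. w l * ((\<xi> l + v l)^2 - 1))}"
    by (rule finite_measure_mono) (use \<kappa> in \<open>auto intro!: mult_left_mono\<close>)
  also have "\<dots> \<le> exp (- ((- \<kappa>) * t)) * (\<Prod>l\<in>S. exp (- ((- \<kappa>) * w l)) *
        (exp ((- \<kappa>) * w l * (v l)^2 / (1 - 2 * ((- \<kappa>) * w l))) / sqrt (1 - 2 * ((- \<kappa>) * w l))))"
  proof (rule noise_chernoff[OF S])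
    fix l assume "l \<in> S"
    from lw(1)[OF this] show "- \<kappa> * w l < 1/2" by simp
  qed
  also have "\<dots> \<le> exp (- ((- \<kappa>) * t)) * (\<Prod>l\<in>S. exp (\<kappa>^2 * (w l)^2 + - (\<kappa> / ?D) * (w l * (v l)^2)))"
  proof (intro mult_left_mono prod_mono conjI)
    fix l assume l: "l \<in> S"
    have 1: "exp (\<kappa> * w l) / sqrt (1 + 2 * (\<kappa> * w l)) \<le> exp ((\<kappa> * w l)^2)"
      by (rule lower_factor_bound) (use lw[OF l] in auto)
    have "\<kappa> * w l * (v l)^2 / ?D \<le> \<kappa> * w l * (v l)^2 / (1 + 2 * (\<kappa> * w l))"
      using lw[OF l] D by (intro divide_left_mono mult_pos_pos) auto
    then have 2: "exp (- (\<kappa> * w l * (v l)^2 / (1 + 2 * (\<kappa> * w l)))) \<le> exp (- (\<kappa> * w l * (v l)^2 / ?D))"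
      by simp
    have "exp (\<kappa> * w l) / sqrt (1 + 2 * (\<kappa> * w l)) * exp (- (\<kappa> * w l * (v l)^2 / (1 + 2 * (\<kappa> * w l))))
        \<le> exp ((\<kappa> * w l)^2) * exp (- (\<kappa> * w l * (v l)^2 / ?D))"
      by (rule mult_mono[OF 1 2]) auto
    also have "\<dots> = exp (\<kappa>^2 * (w l)^2 + - (\<kappa> / ?D) * (w l * (v l)^2))"
      unfolding exp_add[symmetric] by (simp add: power_mult_distrib mult_ac)
    finally show "exp (- ((- \<kappa>) * w l)) * (exp ((- \<kappa>) * w l * (v l)^2 / (1 - 2 * ((- \<kappa>) * w l))) / sqrt (1 - 2 * ((- \<kappa>) * w l)))
        \<le> exp (\<kappa>^2 * (w l)^2 + - (\<kappa> / ?D) * (w l * (v l)^2))" by simp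
    show "0 \<le> exp (- ((- \<kappa>) * w l)) * (exp ((- \<kappa>) * w l * (v l)^2 / (1 - 2 * ((- \<kappa>) * w l))) / sqrt (1 - 2 * ((- \<kappa>) * w l)))"
      using lw[OF l] by (intro mult_nonneg_nonneg divide_nonneg_nonneg) auto
  qed simp
  also have "(\<Prod>l\<in>S. exp (\<kappa>^2 * (w l)^2 + - (\<kappa> / ?D) * (w l * (v l)^2)))
      = exp (\<kappa>^2 * (\<Sum>l\<in>S. (w l)^2) + - (\<kappa> / ?D) * (\<Sum>l\<in>S. w l * (v l)^2))"
    using S by (simp only: exp_sum[symmetric] sum.distrib sum_distrib_left)
  also have "\<dots> \<le> exp (\<kappa>^2 * (1/2) + - (\<kappa> / ?D) * A)"
  proof -
    have "\<kappa> / ?D * A \<le> \<kappa> / ?D * (\<Sum>l\<in>S. w l * (v l)^2)" using A \<kappa> D by (intro mult_left_mono) auto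
    then show ?thesis unfolding half by simp
  qed
  finally show ?thesis by (simp add: exp_add[symmetric] algebra_simps)
qed

section \<open>Error probabilities of the selector\<close>

lemma Ucal_finite: "finite (Ucal k d)" "u \<in> Ucal k d \<Longrightarrow> finite u" "u \<in> Ucal k d \<Longrightarrow> card u = k"
  by (auto simp: Ucal_def intro: finite_subset)

lemma card_Ucal: "card (Ucal k d) = d choose k"
  unfolding Ucal_def by (subst n_subsets) auto

lemma Zring_subset_index_set: "u \<in> Ucal k d \<Longrightarrow> Zring u \<subseteq> index_set d k"
  by (auto simp: index_set_def)

text \<open>Finite support turns the \<open>infsum\<close>, which would be 0 by default without
  convergence, into a finite sum. Every point of \<open>Zring u\<close> has support
  \<open>u\<close>, which selects the component in \<open>obs\<close>.\<close>

lemma Sstat_obs: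
  assumes "\<epsilon> \<noteq> 0" "finite S" "S \<subseteq> Zring u"
    and "\<forall>l\<in>Zring u - S. omega \<sigma> \<epsilon> k u (rstar \<sigma> \<epsilon> d k (real m * \<rho>)) l = 0"
  shows "Sstat \<sigma> \<epsilon> d k \<rho> (obs \<epsilon> \<eta> \<theta> \<xi>) u m =
    (\<Sum>l\<in>S. omega \<sigma> \<epsilon> k u (rstar \<sigma> \<epsilon> d k (real m * \<rho>)) l * ((\<xi> l + \<eta> u * \<theta> u l / \<epsilon>)^2 - 1))"
proof -
  have "Sstat \<sigma> \<epsilon> d k \<rho> (obs \<epsilon> \<eta> \<theta> \<xi>) u m =
    (\<Sum>\<^sub>\<infinity>l\<in>S. omega \<sigma> \<epsilon> k u (rstar \<sigma> \<epsilon> d k (real m * \<rho>)) l * ((\<xi> l + \<eta> u * \<theta> u l / \<epsilon>)^2 - 1))"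
    unfolding Sstat_def
  proof (rule infsum_cong_neutral)
    fix l assume "l \<in> Zring u \<inter> S"
    then have "obs \<epsilon> \<eta> \<theta> \<xi> l / \<epsilon> = \<xi> l + \<eta> u * \<theta> u l / \<epsilon>"
      using assms(1) supp_Zring[of l u] by (simp add: obs_def add_divide_distrib)
    then show "omega \<sigma> \<epsilon> k u (rstar \<sigma> \<epsilon> d k (real m * \<rho>)) l * ((obs \<epsilon> \<eta> \<theta> \<xi> l / \<epsilon>)^2 - 1)
      = omega \<sigma> \<epsilon> k u (rstar \<sigma> \<epsilon> d k (real m * \<rho>)) l * ((\<xi> l + \<eta> u * \<theta> u l / \<epsilon>)^2 - 1)" by simp
  qed (use assms in auto)
  then show ?thesis using assms by simp
qed

lemma Mk_bound:
  assumes "0 < \<rho>" "m \<in> {1..Mk \<rho>}" shows "0 < real m * \<rho>" "real m * \<rho> \<le> 1"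
proof -
  show "0 < real m * \<rho>" using assms by auto
  have "real m \<le> real (Mk \<rho>)" using assms by simp
  also have "\<dots> \<le> 1 / \<rho>" using assms(1) by (simp add: Mk_def)
  finally show "real m * \<rho> \<le> 1" using assms(1) by (simp add: field_simps)
qed

definition threshold :: "nat \<Rightarrow> nat \<Rightarrow> real \<Rightarrow> real \<Rightarrow> real" where
  "threshold d k \<rho> ep = sqrt ((2 + ep) * (ln (real (d choose k)) + ln (real (Mk \<rho>))))"

lemma statistic_weights:
  assumes \<sigma>: "0 < \<sigma>" and \<epsilon>: "0 < \<epsilon>" and k: "1 \<le> k" and L: "0 < ln (real (d choose k))"
    and small: "16 * \<epsilon>^4 * ln (real (d choose k)) * 2^k * (level_cost \<sigma> (real k))^2 < 1"
    and \<rho>: "0 < \<rho>" and m: "m \<in> {1..Mk \<rho>}" and u: "u \<in> Ucal k d"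
  obtains S w where "finite S" "S \<subseteq> Zring u" "(\<Sum>l\<in>S. (w l)^2) = 1/2"
    "\<And>l. l \<in> S \<Longrightarrow> 0 \<le> w l \<and> w l \<le> sqrt (1/2^k)"
    "\<And>\<eta> \<theta> \<xi>. Sstat \<sigma> \<epsilon> d k \<rho> (obs \<epsilon> \<eta> \<theta> \<xi>) u m = (\<Sum>l\<in>S. w l * ((\<xi> l + \<eta> u * \<theta> u l / \<epsilon>)^2 - 1))"
    "\<And>r \<theta>. 0 < r \<Longrightarrow> \<theta> \<in> Theta_c \<sigma> u r \<Longrightarrow>
       ereal ((1 + sqrt (1 - real m * \<rho>)) * sqrt (2 * ln (real (d choose k)))) < a_eps \<sigma> \<epsilon> k r \<Longrightarrow>
       (1 + sqrt (1 - real m * \<rho>)) * sqrt (2 * ln (real (d choose k))) \<le> (\<Sum>l\<in>S. w l * (\<theta> l / \<epsilon>)^2)"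
proof -
  let ?L = "ln (real (d choose k))"
  let ?A = "(1 + sqrt (1 - real m * \<rho>)) * sqrt (2 * ?L)"
  let ?w = "omega \<sigma> \<epsilon> k u (rstar \<sigma> \<epsilon> d k (real m * \<rho>))"
  note b = Mk_bound[OF \<rho> m]
  have s: "0 \<le> sqrt (1 - real m * \<rho>)" "sqrt (1 - real m * \<rho>) \<le> 1" using b by auto
  have A: "0 < ?A" using s L by (simp add: add_pos_nonneg)
  \<comment> \<open>Every grid level is at most \<open>2 * sqrt (2 * L)\<close>, with
    \<open>L\<close> the log cardinality, so \<open>2 * \<epsilon>^4 * A^2\<close> is at most
    \<open>16 * \<epsilon>^4 * L\<close> for all grid points at once; hence the 16 in
    \<open>small\<close>.\<close>
  have "?A \<le> 2 * sqrt (2 * ?L)" using s L by (intro mult_right_mono) auto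
  then have "?A^2 \<le> (2 * sqrt (2 * ?L))^2" using A by (intro power_mono) auto
  also have "\<dots> = 8 * ?L" using L by (simp add: power_mult_distrib)
  finally have A2: "?A^2 \<le> 8 * ?L" .
  have "2 * \<epsilon>^4 * ?A^2 * 2^k * (level_cost \<sigma> (real k))^2 \<le> 2 * \<epsilon>^4 * (8 * ?L) * 2^k * (level_cost \<sigma> (real k))^2"
    by (rule mult_right_mono, rule mult_right_mono, rule mult_left_mono[OF A2]) auto
  also have "\<dots> < 1" using small by (simp add: mult_ac)
  finally have sm: "2 * \<epsilon>^4 * ?A^2 * 2^k * (level_cost \<sigma> (real k))^2 < 1" .
  from omega_properties[OF \<sigma> \<epsilon> Ucal_finite(2)[OF u] Ucal_finite(3)[OF u] k A sm, folded rstar_def]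
  obtain S where S: "finite S" "S \<subseteq> Zring u" "\<forall>l\<in>Zring u - S. ?w l = 0" "(\<Sum>l\<in>S. (?w l)^2) = 1/2"
    "\<forall>l\<in>S. 0 \<le> ?w l \<and> ?w l \<le> sqrt (1/2^k)"
    "\<forall>r \<theta>. 0 < r \<longrightarrow> ereal ?A < a_eps \<sigma> \<epsilon> k r \<longrightarrow> \<theta> \<in> Theta_c \<sigma> u r \<longrightarrow> ?A \<le> (\<Sum>l\<in>S. ?w l * (\<theta> l / \<epsilon>)^2)"
    by blast
  have e: "\<epsilon> \<noteq> 0" using \<epsilon> by simp
  show thesis
    by (rule that[of S ?w]) (use S Sstat_obs[OF e S(1-3)] in blast)+
qed

lemma Sstat_measurable:
  assumes "0 < \<sigma>" "0 < \<epsilon>" "1 \<le> k" "0 < ln (real (d choose k))"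
    "16 * \<epsilon>^4 * ln (real (d choose k)) * 2^k * (level_cost \<sigma> (real k))^2 < 1"
    "0 < \<rho>" "m \<in> {1..Mk \<rho>}" "u \<in> Ucal k d"
  shows "(\<lambda>\<xi>. Sstat \<sigma> \<epsilon> d k \<rho> (obs \<epsilon> \<eta> \<theta> \<xi>) u m) \<in> borel_measurable (noise d k)"
proof (rule statistic_weights[OF assms])
  fix S w assume S: "finite S" "S \<subseteq> Zring u"
    "\<And>\<eta> \<theta> \<xi>. Sstat \<sigma> \<epsilon> d k \<rho> (obs \<epsilon> \<eta> \<theta> \<xi>) u m = (\<Sum>l\<in>S. w l * ((\<xi> l + \<eta> u * \<theta> u l / \<epsilon>)^2 - 1))"
  have [measurable]: "(\<lambda>\<xi>. \<xi> l) \<in> borel_measurable (noise d k)" if "l \<in> S" for l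
    using that S Zring_subset_index_set[OF assms(8)] by (intro measurable_noise_coordinate) auto
  show ?thesis unfolding S(3) by measurable
qed

text \<open>The upper tail bound with \<open>\<kappa> = t\<close>, the minimiser of
  \<open>- \<kappa> * t + \<kappa>^2 / 2\<close>; the cubic term comes from the weight
  correction.\<close>

lemma false_positive_bound:
  assumes a: "0 < \<sigma>" "0 < \<epsilon>" "1 \<le> k" "0 < ln (real (d choose k))"
    "16 * \<epsilon>^4 * ln (real (d choose k)) * 2^k * (level_cost \<sigma> (real k))^2 < 1"
    "0 < \<rho>" "m \<in> {1..Mk \<rho>}" "u \<in> Ucal k d"
    and t: "0 \<le> t" "t * sqrt (1/2^k) \<le> 1/4" and \<eta>: "\<eta> u = 0"
  shows "measure (noise d k) {\<xi>\<in>space (noise d k). t < Sstat \<sigma> \<epsilon> d k \<rho> (obs \<epsilon> \<eta> \<theta> \<xi>) u m}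
    \<le> exp (- (t^2 / 2) + 2 * t^3 * sqrt (1/2^k))"
proof (rule statistic_weights[OF a])
  fix S w assume S: "finite S" "S \<subseteq> Zring u" "(\<Sum>l\<in>S. (w l)^2) = 1/2"
    "\<And>l. l \<in> S \<Longrightarrow> 0 \<le> w l \<and> w l \<le> sqrt (1/2^k)"
    "\<And>\<eta> \<theta> \<xi>. Sstat \<sigma> \<epsilon> d k \<rho> (obs \<epsilon> \<eta> \<theta> \<xi>) u m = (\<Sum>l\<in>S. w l * ((\<xi> l + \<eta> u * \<theta> u l / \<epsilon>)^2 - 1))"
  have "S \<subseteq> index_set d k" using S Zring_subset_index_set[OF a(8)] by blast
  from noise_upper_tail[OF S(1) this t S(4) S(3), of t]
  have "measure (noise d k) {\<xi>\<in>space (noise d k). t < Sstat \<sigma> \<epsilon> d k \<rho> (obs \<epsilon> \<eta> \<theta> \<xi>) u m}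
    \<le> exp (- t * t + t^2 / 2 * (1 + 4 * t * sqrt (1/2^k)))"
    unfolding S(5) by (simp add: \<eta>)
  also have "- t * t + t^2 / 2 * (1 + 4 * t * sqrt (1/2^k)) = - (t^2 / 2) + 2 * t^3 * sqrt (1/2^k)"
    unfolding distrib_left by (simp add: power2_eq_square power3_eq_cube)
  finally show ?thesis .
qed

lemma false_negative_bound:
  assumes a: "0 < \<sigma>" "0 < \<epsilon>" "1 \<le> k" "0 < ln (real (d choose k))"
    "16 * \<epsilon>^4 * ln (real (d choose k)) * 2^k * (level_cost \<sigma> (real k))^2 < 1"
    "0 < \<rho>" "m \<in> {1..Mk \<rho>}" "u \<in> Ucal k d"
    and r: "0 < r" "\<theta> u \<in> Theta_c \<sigma> u r"
      "ereal ((1 + sqrt (1 - real m * \<rho>)) * sqrt (2 * ln (real (d choose k)))) < a_eps \<sigma> \<epsilon> k r"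
    and \<kappa>: "0 \<le> \<kappa>" and \<eta>: "\<eta> u = 1"
  shows "measure (noise d k) {\<xi>\<in>space (noise d k). Sstat \<sigma> \<epsilon> d k \<rho> (obs \<epsilon> \<eta> \<theta> \<xi>) u m \<le> t}
    \<le> exp (\<kappa> * t + \<kappa>^2 / 2 - \<kappa> * ((1 + sqrt (1 - real m * \<rho>)) * sqrt (2 * ln (real (d choose k))))
         / (1 + 2 * \<kappa> * sqrt (1/2^k)))"
proof (rule statistic_weights[OF a])
  fix S w assume S: "finite S" "S \<subseteq> Zring u" "(\<Sum>l\<in>S. (w l)^2) = 1/2"
    "\<And>l. l \<in> S \<Longrightarrow> 0 \<le> w l \<and> w l \<le> sqrt (1/2^k)"
    "\<And>\<eta> \<theta> \<xi>. Sstat \<sigma> \<epsilon> d k \<rho> (obs \<epsilon> \<eta> \<theta> \<xi>) u m = (\<Sum>l\<in>S. w l * ((\<xi> l + \<eta> u * \<theta> u l / \<epsilon>)^2 - 1))"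
    "\<And>r \<theta>. 0 < r \<Longrightarrow> \<theta> \<in> Theta_c \<sigma> u r \<Longrightarrow>
       ereal ((1 + sqrt (1 - real m * \<rho>)) * sqrt (2 * ln (real (d choose k)))) < a_eps \<sigma> \<epsilon> k r \<Longrightarrow>
       (1 + sqrt (1 - real m * \<rho>)) * sqrt (2 * ln (real (d choose k))) \<le> (\<Sum>l\<in>S. w l * (\<theta> l / \<epsilon>)^2)"
  have I: "S \<subseteq> index_set d k" using S Zring_subset_index_set[OF a(8)] by blast
  show ?thesis
    unfolding S(5) \<eta> mult_1_left by (rule noise_lower_tail[OF S(1) I \<kappa> S(4) S(3) _ S(6)[OF r]]) auto
qed

text \<open>A false positive needs one of the grid statistics to be large, which costs a factor
  \<open>Mk \<rho>\<close>. A false negative needs all of them to be small, so a single well chosen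
  index \<open>m0\<close> suffices.\<close>

lemma risk_bound:
  fixes \<rho> ep :: real
  assumes a: "0 < \<sigma>" "0 < \<epsilon>" "1 \<le> k" "0 < ln (real (d choose k))"
    "16 * \<epsilon>^4 * ln (real (d choose k)) * 2^k * (level_cost \<sigma> (real k))^2 < 1" "0 < \<rho>"
    and m0: "m0 \<in> {1..Mk \<rho>}"
    and t: "0 \<le> threshold d k \<rho> ep" "threshold d k \<rho> ep * sqrt (1/2^k) \<le> 1/4"
    and \<eta>: "\<forall>u\<in>Ucal k d. \<eta> u \<in> {0, 1}" and \<theta>: "\<forall>u\<in>Ucal k d. \<theta> u \<in> Theta_c \<sigma> u r"
    and r: "0 < r" "ereal ((1 + sqrt (1 - real m0 * \<rho>)) * sqrt (2 * ln (real (d choose k)))) < a_eps \<sigma> \<epsilon> k r"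
    and \<kappa>: "0 \<le> \<kappa>"
  defines "t \<equiv> threshold d k \<rho> ep" and "W \<equiv> sqrt (1/2^k)"
  shows "\<bar>risk \<sigma> \<epsilon> d k \<rho> ep \<eta> \<theta>\<bar> \<le> real (d choose k) * (real (Mk \<rho>) * exp (- (t^2 / 2) + 2 * t^3 * W))
    + (\<Sum>u\<in>Ucal k d. \<eta> u) * exp (\<kappa> * t + \<kappa>^2 / 2 - \<kappa> * ((1 + sqrt (1 - real m0 * \<rho>)) * sqrt (2 * ln (real (d choose k))))
         / (1 + 2 * \<kappa> * W))"
proof -
  let ?P = "noise d k"
  let ?U = "Ucal k d"
  define S where "S u m \<xi> = Sstat \<sigma> \<epsilon> d k \<rho> (obs \<epsilon> \<eta> \<theta> \<xi>) u m" for u m \<xi>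
  define D where "D u \<xi> \<longleftrightarrow> (\<exists>m\<in>{1..Mk \<rho>}. t < S u m \<xi>)" for u \<xi>
  \<comment> \<open>The error event: equality of the truth values means detection of an inactive
    component or a miss of an active one.\<close>
  define E where "E u = {\<xi>\<in>space ?P. D u \<xi> = (\<eta> u = 0)}" for u
  define p where "p = exp (- (t^2 / 2) + 2 * t^3 * W)"
  define q where "q = exp (\<kappa> * t + \<kappa>^2 / 2 - \<kappa> * ((1 + sqrt (1 - real m0 * \<rho>)) * sqrt (2 * ln (real (d choose k))))
         / (1 + 2 * \<kappa> * W))"
  interpret prob_space ?P by (rule prob_space_noise)
  have Sm [measurable]: "S u m \<in> borel_measurable ?P" if "u \<in> ?U" "m \<in> {1..Mk \<rho>}" for u m
    unfolding S_def using Sstat_measurable[OF a that(2,1)] .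
  have Dm: "{\<xi>\<in>space ?P. D u \<xi>} \<in> sets ?P" if u: "u \<in> ?U" for u
  proof -
    have "{\<xi>\<in>space ?P. D u \<xi>} = (\<Union>m\<in>{1..Mk \<rho>}. {\<xi>\<in>space ?P. t < S u m \<xi>})"
      by (auto simp: D_def)
    also have "\<dots> \<in> sets ?P" using Sm[OF u] by (intro sets.finite_UN) auto
    finally show ?thesis .
  qed
  have Em: "E u \<in> sets ?P" if u: "u \<in> ?U" for u
  proof (cases "\<eta> u = 0")
    case True then show ?thesis using Dm[OF u] by (simp add: E_def)
  next
    case False
    then have "E u = space ?P - {\<xi>\<in>space ?P. D u \<xi>}" by (auto simp: E_def)
    then show ?thesis using Dm[OF u] by auto
  qed
  have ind: "\<bar>\<eta> u - etahat \<sigma> \<epsilon> d k \<rho> ep (obs \<epsilon> \<eta> \<theta> \<xi>) u\<bar> = indicator (E u) \<xi>"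
    if "u \<in> ?U" "\<xi> \<in> space ?P" for u \<xi>
  proof -
    have "etahat \<sigma> \<epsilon> d k \<rho> ep (obs \<epsilon> \<eta> \<theta> \<xi>) u = (if D u \<xi> then 1 else 0)"
      by (simp add: etahat_def D_def S_def t_def threshold_def)
    then show ?thesis using that \<eta> by (auto simp: E_def indicator_def)
  qed
  have "risk \<sigma> \<epsilon> d k \<rho> ep \<eta> \<theta> = (\<integral>\<xi>. (\<Sum>u\<in>?U. indicator (E u) \<xi>) \<partial>?P)"
    unfolding risk_def by (intro Bochner_Integration.integral_cong sum.cong refl ind) auto
  also have "\<dots> = (\<Sum>u\<in>?U. \<integral>\<xi>. indicator (E u) \<xi> \<partial>?P)"
    by (rule Bochner_Integration.integral_sum) (use Em in \<open>auto simp: emeasure_eq_measure\<close>)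
  also have "\<dots> = (\<Sum>u\<in>?U. measure ?P (E u))"
    using Em sets.sets_into_space by (intro sum.cong refl) (simp add: Int_absorb2)
  finally have risk: "risk \<sigma> \<epsilon> d k \<rho> ep \<eta> \<theta> = (\<Sum>u\<in>?U. measure ?P (E u))" .
  have "(\<Sum>u\<in>?U. measure ?P (E u)) \<le> (\<Sum>u\<in>?U. real (Mk \<rho>) * p + \<eta> u * q)"
  proof (rule sum_mono)
    fix u assume u: "u \<in> ?U"
    consider "\<eta> u = 0" | "\<eta> u = 1" using \<eta> u by auto
    then show "measure ?P (E u) \<le> real (Mk \<rho>) * p + \<eta> u * q"
    proof cases
      case 1
      have "E u = (\<Union>m\<in>{1..Mk \<rho>}. {\<xi>\<in>space ?P. t < S u m \<xi>})"
        using 1 by (auto simp: E_def D_def)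
      also have "measure ?P \<dots> \<le> (\<Sum>m\<in>{1..Mk \<rho>}. measure ?P {\<xi>\<in>space ?P. t < S u m \<xi>})"
        using Sm[OF u] by (intro finite_measure_subadditive_finite) auto
      also have "\<dots> \<le> (\<Sum>m\<in>{1..Mk \<rho>}. p)"
        unfolding S_def p_def W_def t_def
        by (intro sum_mono false_positive_bound[OF a _ u] assms(8,9) 1)
      finally show ?thesis using 1 by simp
    next
      case 2
      have "measure ?P (E u) \<le> measure ?P {\<xi>\<in>space ?P. S u m0 \<xi> \<le> t}"
        using Sm[OF u m0] 2 m0 by (intro finite_measure_mono) (auto simp: E_def D_def not_less)
      also have "\<dots> \<le> q"
        unfolding S_def q_def W_def
        using \<theta> u by (intro false_negative_bound[where r = r] a m0 u r \<kappa> 2) blast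
      finally show ?thesis using 2 by (simp add: p_def add_increasing)
    qed
  qed
  also have "\<dots> = real (d choose k) * (real (Mk \<rho>) * p) + (\<Sum>u\<in>?U. \<eta> u) * q"
    by (simp add: sum.distrib card_Ucal sum_distrib_right)
  finally show ?thesis
    unfolding risk p_def q_def by (simp add: sum_nonneg)
qed

section \<open>Asymptotics\<close>

text \<open>For \<open>\<tau> = 1\<close> and \<open>W = 0\<close> the left side is
  \<open>2 * L * s + L * s^2 - 2 * L * s * (1 + s) = - L * s^2\<close>. The other terms account for
  the inflated threshold and, via \<open>1 / (1 + 2 * x) \<ge> 1 - 2 * x\<close>, for the
  weights.\<close>

lemma false_negative_exponent:
  fixes s :: real
  assumes s: "0 \<le> s" "s \<le> 1" and L: "0 < L" and W: "0 \<le> W" and \<tau>: "1 \<le> \<tau>"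
  defines "\<kappa> \<equiv> s * sqrt (2 * L)"
  shows "\<kappa> * (\<tau> * sqrt (2 * L)) + \<kappa>^2 / 2 - \<kappa> * ((1 + s) * sqrt (2 * L)) / (1 + 2 * \<kappa> * W)
    \<le> L * (2 * (\<tau> - 1) - s^2 + 8 * (\<kappa> * W))"
proof -
  have r: "sqrt (2 * L) * sqrt (2 * L) = 2 * L" using L by simp
  have \<kappa>: "0 \<le> \<kappa>" using s L by (simp add: \<kappa>_def)
  have x: "0 \<le> \<kappa> * W" using \<kappa> W by simp
  have 1: "\<kappa> * (\<tau> * sqrt (2 * L)) = 2 * L * (s * \<tau>)"
    unfolding \<kappa>_def using r by (metis mult.assoc mult.commute)
  have 2: "\<kappa>^2 / 2 = L * s^2" unfolding \<kappa>_def using L by (simp add: power_mult_distrib)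
  have 3: "\<kappa> * ((1 + s) * sqrt (2 * L)) = 2 * L * (s * (1 + s))"
    unfolding \<kappa>_def using r by (metis mult.assoc mult.commute)
  have "(1 - 2 * (\<kappa> * W)) * (1 + 2 * \<kappa> * W) \<le> 1"
    using zero_le_power2[of "\<kappa> * W"] by (simp add: algebra_simps power2_eq_square)
  then have "1 - 2 * (\<kappa> * W) \<le> 1 / (1 + 2 * \<kappa> * W)"
    using x by (subst pos_le_divide_eq) auto
  then have "2 * L * (s * (1 + s)) * (1 - 2 * (\<kappa> * W)) \<le> 2 * L * (s * (1 + s)) * (1 / (1 + 2 * \<kappa> * W))"
    using s L by (intro mult_left_mono) auto
  then have 4: "2 * L * (s * (1 + s)) * (1 - 2 * (\<kappa> * W)) \<le> 2 * L * (s * (1 + s)) / (1 + 2 * \<kappa> * W)"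
    by simp
  have "s * (\<tau> - 1) \<le> 1 * (\<tau> - 1)" using s \<tau> by (intro mult_right_mono) auto
  moreover have "s * (1 + s) * (\<kappa> * W) \<le> 1 * 2 * (\<kappa> * W)"
    using s x by (intro mult_right_mono mult_mono) auto
  ultimately have "2 * (s * (\<tau> - 1)) - s^2 + 4 * (s * (1 + s) * (\<kappa> * W)) \<le> 2 * (\<tau> - 1) - s^2 + 8 * (\<kappa> * W)"
    by linarith
  then have "L * (2 * (s * (\<tau> - 1)) - s^2 + 4 * (s * (1 + s) * (\<kappa> * W))) \<le> L * (2 * (\<tau> - 1) - s^2 + 8 * (\<kappa> * W))"
    using L by (intro mult_left_mono) auto
  moreover have "2 * L * (s * \<tau>) + L * s^2 - 2 * L * (s * (1 + s)) * (1 - 2 * (\<kappa> * W))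
      = L * (2 * (s * (\<tau> - 1)) - s^2 + 4 * (s * (1 + s) * (\<kappa> * W)))"
    by (simp add: algebra_simps power2_eq_square)
  ultimately show ?thesis unfolding 1 2 3 using 4 by linarith
qed

section \<open>Growth of the log cardinality and smallness of the noise level\<close>

lemma ln_binomial_bounds:
  assumes "1 \<le> k" "2 * k \<le> d"
  shows "real k * ln 2 \<le> ln (real (d choose k))" "ln (real (d choose k)) \<le> real k * ln (real d)"
proof -
  have "2 ^ k \<le> (real d / real k) ^ k"
    using assms by (intro power_mono) (auto simp: field_simps)
  also have "\<dots> \<le> real (d choose k)"
    using assms by (intro binomial_ge_n_over_k_pow_k) auto
  finally have 1: "2 ^ k \<le> real (d choose k)" .
  have pos: "0 < real (d choose k)" by (rule less_le_trans[OF _ 1]) simp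
  from 1 have "ln (2 ^ k) \<le> ln (real (d choose k))" using pos by (subst ln_le_cancel_iff) auto
  then show "real k * ln 2 \<le> ln (real (d choose k))" by (simp add: ln_realpow)
  have "d choose k \<le> d ^ k" using assms by (intro binomial_le_pow) auto
  then have "real (d choose k) \<le> real d ^ k" by (metis of_nat_le_iff of_nat_power)
  then have "ln (real (d choose k)) \<le> ln (real d ^ k)"
    using assms pos by (subst ln_le_cancel_iff) auto
  then show "ln (real (d choose k)) \<le> real k * ln (real d)" using assms by (simp add: ln_realpow)
qed

text \<open>Everything is compared with powers of \<open>exp L\<close>: both \<open>16 * L\<close>
  and \<open>2^k\<close> are at most \<open>exp L\<close>, and the squared cost is at most
  \<open>exp (2 * \<sigma> * L)\<close>. The product is below \<open>1 / \<epsilon>\<close>, leaving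
  \<open>\<epsilon>^3\<close>. The 128 arises from \<open>4 * pi^2 \<le> 64\<close> and
  \<open>k \<le> 2 * L\<close>.\<close>

lemma level_cost_small:
  assumes \<sigma>: "0 < \<sigma>" and \<epsilon>: "0 < \<epsilon>" "\<epsilon> < 1"
    and L: "real k * ln 2 \<le> L" "3 \<le> L" "128 * L \<le> exp L" and e: "(3 + 2 * \<sigma>) * L < ln (1 / \<epsilon>)"
  shows "16 * \<epsilon>^4 * L * 2^k * (level_cost \<sigma> (real k))^2 < 1"
proof -
  have "(1/2::real) \<le> ln 2" using ln2_ge_two_thirds by simp
  then have "real k * (1/2) \<le> real k * ln 2" by (intro mult_left_mono) auto
  then have kL: "real k \<le> 2 * L" using L by simp
  have "pi * pi \<le> 4 * 4" using pi_less_4 pi_gt_zero by (intro mult_mono) auto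
  then have "4 * pi^2 * real k \<le> 64 * (2 * L)"
    using kL by (intro mult_mono) (auto simp: power2_eq_square)
  also have "64 * (2 * L) \<le> exp L" using L by simp
  finally have "4 * pi^2 * real k \<le> exp L" .
  then have "level_cost \<sigma> (real k) \<le> exp L powr \<sigma>"
    unfolding level_cost_def using \<sigma> by (intro powr_mono2) auto
  also have "\<dots> = exp (\<sigma> * L)" by (simp add: powr_def)
  finally have "(level_cost \<sigma> (real k))^2 \<le> exp (\<sigma> * L)^2"
    by (intro power_mono) (auto simp: level_cost_def)
  then have c: "(level_cost \<sigma> (real k))^2 \<le> exp (2 * \<sigma> * L)" by (simp add: exp_double[symmetric] mult.assoc)
  have t: "2^k \<le> exp L"
  proof -
    have "(2::real)^k = exp (real k * ln 2)" by (simp add: exp_of_nat_mult)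
    then show ?thesis using L by simp
  qed
  have "16 * L \<le> exp L" "1 \<le> exp L" using L by auto
  have "16 * \<epsilon>^4 * L * 2^k * (level_cost \<sigma> (real k))^2 = \<epsilon>^4 * ((16 * L) * 2^k * (level_cost \<sigma> (real k))^2)"
    by simp
  also have "\<dots> \<le> \<epsilon>^4 * (exp L * exp L * exp (2 * \<sigma> * L))"
    using L t c \<open>16 * L \<le> exp L\<close> by (intro mult_left_mono mult_mono) auto
  also have "\<dots> = \<epsilon>^4 * exp ((2 + 2 * \<sigma>) * L)"
    by (simp add: exp_add[symmetric] algebra_simps)
  also have "\<dots> < \<epsilon>^4 * (1 / \<epsilon>)"
  proof (rule mult_strict_left_mono)
    have "(2 + 2 * \<sigma>) * L \<le> (3 + 2 * \<sigma>) * L" using L by (intro mult_right_mono) auto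
    then have "exp ((2 + 2 * \<sigma>) * L) < exp (ln (1 / \<epsilon>))" using e by simp
    then show "exp ((2 + 2 * \<sigma>) * L) < 1 / \<epsilon>" using \<epsilon> by simp
  qed (use \<epsilon> in simp)
  also have "\<dots> = \<epsilon>^3" using \<epsilon> by (simp add: power4_eq_xxxx power3_eq_cube)
  also have "\<dots> \<le> 1" using \<epsilon> by (simp add: power_le_one)
  finally show ?thesis .
qed

lemma sqrt_inverse_power: "sqrt (1 / 2 ^ k) = exp (- (real k * ln 2 / 2))"
proof -
  have "(2::real)^k = exp (real k * ln 2)" by (simp add: exp_of_nat_mult)
  then have "1 / 2^k = (exp (- (real k * ln 2 / 2)))^2"
    by (simp add: power2_eq_square exp_add[symmetric] exp_minus inverse_eq_divide)
  then show ?thesis by (metis abs_exp_cancel real_sqrt_abs)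
qed

text \<open>The log cardinality is at most \<open>k * exp (k / 20)\<close>, so its square costs
  \<open>exp (k / 10)\<close>, while the weight bound gains \<open>exp (- (k / 5))\<close>. The
  right side has the shape \<open>x^2 / exp x\<close> of a standard limit.\<close>

lemma ln_binomial_square_bound:
  assumes k: "1 \<le> k" and dk: "2 * k \<le> d" and h: "ln (ln (real d)) \<le> real k / 20"
  shows "(ln (real (d choose k)))^2 * sqrt (1 / 2^k) \<le> 100 * ((real k / 10)^2 / exp (real k / 10))"
proof -
  have d: "2 \<le> d" using k dk by simp
  then have ld: "0 < ln (real d)" by simp
  have "0 \<le> ln (real (d choose k))"
    using ln_binomial_bounds(1)[OF k dk] by (smt (verit) ln_gt_zero mult_nonneg_nonneg of_nat_0_le_iff)
  then have "(ln (real (d choose k)))^2 \<le> (real k * ln (real d))^2"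
    using ln_binomial_bounds(2)[OF k dk] by (intro power_mono) auto
  also have "\<dots> \<le> (real k * exp (real k / 20))^2"
  proof (intro power_mono mult_left_mono)
    have "ln (real d) = exp (ln (ln (real d)))" using ld by simp
    also have "\<dots> \<le> exp (real k / 20)" using h by simp
    finally show "ln (real d) \<le> exp (real k / 20)" .
  qed (use ld in auto)
  also have "\<dots> = (real k)^2 * exp (real k / 10)"
    by (simp add: power_mult_distrib power2_eq_square exp_add[symmetric])
  finally have 1: "(ln (real (d choose k)))^2 \<le> (real k)^2 * exp (real k / 10)" .
  have "(1/2::real) \<le> ln 2" using ln2_ge_two_thirds by simp
  then have "real k * (1/2) \<le> real k * ln 2" by (intro mult_left_mono) auto
  then have 2: "sqrt (1 / 2^k) \<le> exp (- (real k / 5))"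
    unfolding sqrt_inverse_power by simp
  have "(ln (real (d choose k)))^2 * sqrt (1 / 2^k) \<le> ((real k)^2 * exp (real k / 10)) * exp (- (real k / 5))"
    by (rule mult_mono[OF 1 2]) auto
  also have "\<dots> = (real k)^2 * exp (- (real k / 10))"
    by (simp add: mult.assoc exp_add[symmetric])
  also have "\<dots> = 100 * ((real k / 10)^2 / exp (real k / 10))"
    by (simp add: power_divide exp_minus inverse_eq_divide)
  finally show ?thesis .
qed

section \<open>The grid and the threshold\<close>

lemma grid_point:
  assumes "0 < \<rho>" "0 < b" "b + \<rho> \<le> c" "c \<le> 1"
  obtains m where "m \<in> {1..Mk \<rho>}" "b \<le> real m * \<rho>" "real m * \<rho> \<le> c"
proof -
  define m where "m = nat \<lceil>b / \<rho>\<rceil>"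
  have p: "0 < b / \<rho>" using assms by simp
  have m: "b / \<rho> \<le> real m" "real m < b / \<rho> + 1" using p by (auto simp: m_def) linarith+
  have 1: "b \<le> real m * \<rho>" using m(1) assms by (simp add: field_simps)
  have "real m * \<rho> < (b / \<rho> + 1) * \<rho>" using m(2) assms by (intro mult_strict_right_mono) auto
  also have "\<dots> = b + \<rho>" using assms by (simp add: distrib_right)
  finally have 2: "real m * \<rho> \<le> c" using assms by simp
  have "real m \<le> 1 / \<rho>" using 2 assms by (simp add: field_simps)
  then have "int m \<le> \<lfloor>1 / \<rho>\<rfloor>" by (simp add: le_floor_iff)
  then have "m \<le> Mk \<rho>" unfolding Mk_def by simp
  moreover have "1 \<le> m" using m(1) p by (cases m) auto
  ultimately show thesis using that 1 2 by auto
qed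

lemma threshold_bounds:
  assumes ep: "0 < ep" "ep \<le> 1" and L: "1 \<le> L" "L = ln (real (d choose k))"
    and M: "1 \<le> Mk \<rho>" "ln (real (Mk \<rho>)) \<le> L"
  shows "1 \<le> threshold d k \<rho> ep" "(threshold d k \<rho> ep)^2 = (2 + ep) * (L + ln (real (Mk \<rho>)))"
    "threshold d k \<rho> ep ^ 4 \<le> 36 * L^2"
proof -
  have l: "0 \<le> ln (real (Mk \<rho>))" using M by simp
  have "1 * 1 \<le> (2 + ep) * (L + ln (real (Mk \<rho>)))" using ep L l by (intro mult_mono) auto
  then show "1 \<le> threshold d k \<rho> ep" unfolding threshold_def L(2)[symmetric] by simp
  show sq: "(threshold d k \<rho> ep)^2 = (2 + ep) * (L + ln (real (Mk \<rho>)))"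
    unfolding threshold_def L(2)[symmetric] using ep L l by simp
  have "(2 + ep) * (L + ln (real (Mk \<rho>))) \<le> 3 * (L + L)" using ep L l M by (intro mult_mono) auto
  then have "((threshold d k \<rho> ep)^2)^2 \<le> (6 * L)^2" unfolding sq using ep L l by (intro power_mono) auto
  then show "threshold d k \<rho> ep ^ 4 \<le> 36 * L^2" by (simp add: power_mult_distrib)
qed

text \<open>The union bound costs \<open>L + ln (Mk \<rho>)\<close> in the exponent and the
  threshold returns this times \<open>1 + ep / 2\<close>, leaving \<open>ep * L / 2\<close>. Since
  \<open>1 \<le> t\<close>, the correction obeys
  \<open>2 * t^3 * W \<le> 2 * t^4 * W \<le> 72 * L^2 * W\<close>.\<close>

lemma false_positive_total:
  assumes ep: "0 < ep" "ep \<le> 1" and L: "1 \<le> L" "L = ln (real (d choose k))"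
    and M: "1 \<le> Mk \<rho>" "ln (real (Mk \<rho>)) \<le> L" and W: "0 \<le> W"
  defines "t \<equiv> threshold d k \<rho> ep"
  shows "real (d choose k) * (real (Mk \<rho>) * exp (- (t^2 / 2) + 2 * t^3 * W))
    \<le> exp (- (ep * L) / 2 + 72 * (L^2 * W))"
proof -
  note tb = threshold_bounds[OF ep L M, folded t_def]
  have l: "0 \<le> ln (real (Mk \<rho>))" using M by simp
  have "0 < real (d choose k)" using L by (cases "d choose k = 0") auto
  then have C: "real (d choose k) = exp L" using L by simp
  have M': "real (Mk \<rho>) = exp (ln (real (Mk \<rho>)))" using M by simp
  have "t^3 \<le> t^4" using tb(1) by (intro power_increasing) auto
  then have "t^3 * W \<le> 36 * L^2 * W" using tb(3) W by (intro mult_right_mono) auto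
  moreover have "0 \<le> ep * ln (real (Mk \<rho>))" using ep l by simp
  then have "L + ln (real (Mk \<rho>)) - t^2 / 2 \<le> - (ep * L) / 2"
    unfolding tb(2) by (simp add: algebra_simps add_divide_distrib)
  ultimately have "L + (ln (real (Mk \<rho>)) + (- (t^2 / 2) + 2 * t^3 * W)) \<le> - (ep * L) / 2 + 72 * (L^2 * W)"
    by linarith
  then show ?thesis
    unfolding C by (subst M') (simp only: exp_add[symmetric] exp_le_cancel_iff)
qed


text \<open>The suprema are expressed by arbitrary families \<open>\<eta>\<close> and
  \<open>\<theta>\<close> indexed by the noise level: near-maximisers form such families, so
  convergence along all of them is uniform convergence.\<close>

theorem theorem3:
  fixes \<beta> \<sigma> :: real and d k :: "real \<Rightarrow> nat" and r \<rho> ep :: "real \<Rightarrow> real"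
    and \<eta> :: "real \<Rightarrow> nat set \<Rightarrow> real"
    and \<theta> :: "real \<Rightarrow> nat set \<Rightarrow> (nat \<Rightarrow> int) \<Rightarrow> real"
  assumes "0 < \<beta>" "\<beta> < 1" "\<sigma> > 0"
    and "filterlim d at_top (at_right 0)" "filterlim k at_top (at_right 0)"
    and "((\<lambda>\<epsilon>. real (k \<epsilon>) / real (d \<epsilon>)) \<longlongrightarrow> 0) (at_right 0)"
    and "((\<lambda>\<epsilon>. ln (ln (real (d \<epsilon>))) / real (k \<epsilon>)) \<longlongrightarrow> 0) (at_right 0)"
    and "((\<lambda>\<epsilon>. ln (real (d \<epsilon> choose k \<epsilon>)) / ln (1 / \<epsilon>)) \<longlongrightarrow> 0) (at_right 0)"
    and "\<forall>\<epsilon>>0. r \<epsilon> > 0"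
    and "Liminf (at_right 0)
           (\<lambda>\<epsilon>. a_eps \<sigma> \<epsilon> (k \<epsilon>) (r \<epsilon>) / ereal (sqrt (ln (real (d \<epsilon> choose k \<epsilon>)))))
         > ereal (sqrt 2 * (1 + sqrt (1 - \<beta>)))"
    and "\<forall>\<epsilon>>0. \<rho> \<epsilon> > 0" "(\<rho> \<longlongrightarrow> 0) (at_right 0)"
    and "((\<lambda>\<epsilon>. ln (real (Mk (\<rho> \<epsilon>))) / ln (real (d \<epsilon> choose k \<epsilon>))) \<longlongrightarrow> 0) (at_right 0)"
    and "\<forall>\<epsilon>>0. ep \<epsilon> > 0" "(ep \<longlongrightarrow> 0) (at_right 0)"
    and "filterlim (\<lambda>\<epsilon>. ep \<epsilon> * ln (real (d \<epsilon> choose k \<epsilon>))) at_top (at_right 0)"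
    and "\<forall>\<^sub>F \<epsilon> in at_right 0. \<forall>u\<in>Ucal (k \<epsilon>) (d \<epsilon>). \<eta> \<epsilon> u \<in> {0, 1}"
    and "((\<lambda>\<epsilon>. (\<Sum>u\<in>Ucal (k \<epsilon>) (d \<epsilon>). \<eta> \<epsilon> u) / real (d \<epsilon> choose k \<epsilon>) powr (1 - \<beta>))
           \<longlongrightarrow> 1) (at_right 0)"
    and "\<forall>\<^sub>F \<epsilon> in at_right 0. \<forall>u\<in>Ucal (k \<epsilon>) (d \<epsilon>). \<theta> \<epsilon> u \<in> Theta_c \<sigma> u (r \<epsilon>)"
  shows "((\<lambda>\<epsilon>. risk \<sigma> \<epsilon> (d \<epsilon>) (k \<epsilon>) (\<rho> \<epsilon>) (ep \<epsilon>) (\<eta> \<epsilon>) (\<theta> \<epsilon>)) \<longlongrightarrow> 0) (at_right 0)"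
proof -
  let ?F = "at_right (0::real)"
  define L where "L \<epsilon> = ln (real (d \<epsilon> choose k \<epsilon>))" for \<epsilon>
  define W where "W \<epsilon> = sqrt (1 / 2 ^ k \<epsilon>)" for \<epsilon>
  define M where "M \<epsilon> = ln (real (Mk (\<rho> \<epsilon>)))" for \<epsilon>
  \<comment> \<open>The ratio of the threshold to \<open>sqrt (2 * L)\<close>.\<close>
  define \<tau> where "\<tau> \<epsilon> = sqrt ((1 + ep \<epsilon> / 2) * (1 + M \<epsilon> / L \<epsilon>))" for \<epsilon>
  have W0: "0 \<le> W \<epsilon>" for \<epsilon> by (simp add: W_def)
  have pos: "\<forall>\<^sub>F \<epsilon> in ?F. 0 < \<epsilon> \<and> \<epsilon> < 1"
    using eventually_at_right_real[of 0 1] by (rule eventually_mono) auto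
  have klarge: "\<forall>\<^sub>F \<epsilon> in ?F. N \<le> k \<epsilon>" for N
    using assms(5) by (simp add: filterlim_at_top)
  have dk: "\<forall>\<^sub>F \<epsilon> in ?F. 2 * k \<epsilon> \<le> d \<epsilon>"
  proof -
    have "\<forall>\<^sub>F \<epsilon> in ?F. real (k \<epsilon>) / real (d \<epsilon>) < 1/2"
      using assms(6) by (rule order_tendstoD) simp
    moreover have "\<forall>\<^sub>F \<epsilon> in ?F. 1 \<le> d \<epsilon>" using assms(4) by (simp add: filterlim_at_top)
    ultimately show ?thesis by eventually_elim (simp add: field_simps)
  qed
  have kreal: "filterlim (\<lambda>\<epsilon>. real (k \<epsilon>)) at_top ?F"
    by (rule filterlim_compose[OF filterlim_real_sequentially assms(5)])
  have Ltop: "filterlim L at_top ?F"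
  proof (rule filterlim_at_top_mono)
    show "filterlim (\<lambda>\<epsilon>. ln 2 * real (k \<epsilon>)) at_top ?F"
      by (rule filterlim_tendsto_pos_mult_at_top[OF tendsto_const _ kreal]) simp
    show "\<forall>\<^sub>F \<epsilon> in ?F. ln 2 * real (k \<epsilon>) \<le> L \<epsilon>"
      using klarge[of 1] dk
      by eventually_elim (simp add: L_def ln_binomial_bounds(1) mult.commute[of "ln 2"])
  qed
  have Llarge: "\<forall>\<^sub>F \<epsilon> in ?F. c \<le> L \<epsilon>" for c
    using Ltop by (simp add: filterlim_at_top)
  \<comment> \<open>One quantity controls all weight corrections, in both tails.\<close>
  have L2W: "((\<lambda>\<epsilon>. (L \<epsilon>)^2 * W \<epsilon>) \<longlongrightarrow> 0) ?F"
  proof (rule Lim_null_comparison)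
    have "filterlim (\<lambda>\<epsilon>. (1/10) * real (k \<epsilon>)) at_top ?F"
      by (rule filterlim_tendsto_pos_mult_at_top[OF tendsto_const _ kreal]) simp
    then have "filterlim (\<lambda>\<epsilon>. real (k \<epsilon>) / 10) at_top ?F" by simp
    from filterlim_compose[OF tendsto_power_div_exp_0[of 2] this]
    show "((\<lambda>\<epsilon>. 100 * ((real (k \<epsilon>) / 10)^2 / exp (real (k \<epsilon>) / 10))) \<longlongrightarrow> 0) ?F"
      by (rule tendsto_mult_right_zero)
    have "\<forall>\<^sub>F \<epsilon> in ?F. ln (ln (real (d \<epsilon>))) / real (k \<epsilon>) < 1/20"
      using assms(7) by (rule order_tendstoD) simp
    then show "\<forall>\<^sub>F \<epsilon> in ?F. norm ((L \<epsilon>)^2 * W \<epsilon>) \<le> 100 * ((real (k \<epsilon>) / 10)^2 / exp (real (k \<epsilon>) / 10))"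
      using klarge[of 1] dk
    proof eventually_elim
      case (elim \<epsilon>)
      then have "ln (ln (real (d \<epsilon>))) \<le> real (k \<epsilon>) / 20" by (simp add: field_simps)
      from ln_binomial_square_bound[OF elim(2,3) this] show ?case
        using W0 by (simp add: L_def W_def)
    qed
  qed
  have small: "\<forall>\<^sub>F \<epsilon> in ?F. 16 * \<epsilon>^4 * L \<epsilon> * 2 ^ k \<epsilon> * (level_cost \<sigma> (real (k \<epsilon>)))^2 < 1"
  proof -
    have "((\<lambda>\<epsilon>. L \<epsilon> ^ 1 / exp (L \<epsilon>)) \<longlongrightarrow> 0) ?F"
      by (rule filterlim_compose[OF tendsto_power_div_exp_0 Ltop])
    then have 1: "\<forall>\<^sub>F \<epsilon> in ?F. L \<epsilon> ^ 1 / exp (L \<epsilon>) < 1/128" by (rule order_tendstoD) simp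
    have 2: "\<forall>\<^sub>F \<epsilon> in ?F. L \<epsilon> / ln (1 / \<epsilon>) < 1 / (3 + 2 * \<sigma>)"
      unfolding L_def using assms(8) by (rule order_tendstoD) (use assms(3) in simp)
    show ?thesis
      using 1 2 pos klarge[of 1] dk Llarge[of 3]
    proof eventually_elim
      case (elim \<epsilon>)
      have "0 < ln (1 / \<epsilon>)" using elim(3) by (simp add: ln_div)
      then have e: "(3 + 2 * \<sigma>) * L \<epsilon> < ln (1 / \<epsilon>)"
        using elim(2) assms(3) by (simp add: divide_less_eq less_divide_eq mult.commute)
      show ?case
        by (rule level_cost_small[OF assms(3) _ _ _ elim(6) _ e])
          (use elim ln_binomial_bounds(1)[OF elim(4,5)] in \<open>auto simp: L_def divide_less_eq\<close>)
    qed
  qed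
  have M1: "\<forall>\<^sub>F \<epsilon> in ?F. 1 \<le> Mk (\<rho> \<epsilon>)"
  proof -
    have "\<forall>\<^sub>F \<epsilon> in ?F. \<rho> \<epsilon> < 1" using assms(12) by (rule order_tendstoD) simp
    then show ?thesis using pos
    proof eventually_elim
      case (elim \<epsilon>)
      then have "0 < \<rho> \<epsilon>" using assms(11) by simp
      then have "1 \<le> \<lfloor>1 / \<rho> \<epsilon>\<rfloor>" using elim by (simp add: le_floor_iff)
      then show ?case unfolding Mk_def by linarith
    qed
  qed
  have M_le: "\<forall>\<^sub>F \<epsilon> in ?F. M \<epsilon> \<le> L \<epsilon>"
  proof -
    have "\<forall>\<^sub>F \<epsilon> in ?F. M \<epsilon> / L \<epsilon> < 1" unfolding M_def L_def using assms(13) by (rule order_tendstoD) simp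
    then show ?thesis using Llarge[of 1] by eventually_elim (simp add: divide_less_eq)
  qed
  have ep1: "\<forall>\<^sub>F \<epsilon> in ?F. 0 < ep \<epsilon> \<and> ep \<epsilon> \<le> 1"
  proof -
    have "\<forall>\<^sub>F \<epsilon> in ?F. ep \<epsilon> < 1" using assms(15) by (rule order_tendstoD) simp
    then show ?thesis using pos by eventually_elim (use assms(14) in auto)
  qed
  have \<tau>: "(\<tau> \<longlongrightarrow> 1) ?F"
  proof -
    have "((\<lambda>\<epsilon>. sqrt ((1 + ep \<epsilon> / 2) * (1 + M \<epsilon> / L \<epsilon>))) \<longlongrightarrow> sqrt ((1 + 0 / 2) * (1 + 0))) ?F"
      unfolding M_def L_def by (intro tendsto_intros assms(13,15)) simp
    then show ?thesis by (simp add: \<tau>_def[abs_def])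
  qed
  obtain y where y: "sqrt 2 * (1 + sqrt (1 - \<beta>)) < y"
    and ay: "\<forall>\<^sub>F \<epsilon> in ?F. ereal y < a_eps \<sigma> \<epsilon> (k \<epsilon>) (r \<epsilon>) / ereal (sqrt (L \<epsilon>))"
  proof -
    obtain y where "ereal (sqrt 2 * (1 + sqrt (1 - \<beta>))) < ereal y"
      "ereal y < Liminf ?F (\<lambda>\<epsilon>. a_eps \<sigma> \<epsilon> (k \<epsilon>) (r \<epsilon>) / ereal (sqrt (L \<epsilon>)))"
      using ereal_dense2[OF assms(10)] unfolding L_def by auto
    then show thesis using that less_LiminfD by auto
  qed
  have y2: "1 + sqrt (1 - \<beta>) < y / sqrt 2" using y by (simp add: pos_less_divide_eq mult.commute)
  \<comment> \<open>By continuity the signal still exceeds the level belonging to some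
    \<open>b < \<beta>\<close>. Grid points between \<open>b\<close> and a
    \<open>c < \<beta>\<close> are then detectable and have
    \<open>s^2 > 1 - \<beta>\<close>.\<close>
  have "((\<lambda>b. 1 + sqrt (1 - b)) \<longlongrightarrow> 1 + sqrt (1 - \<beta>)) (at_left \<beta>)" by (intro tendsto_intros)
  from order_tendstoD(2)[OF this y2]
  have "\<forall>\<^sub>F b in at_left \<beta>. 1 + sqrt (1 - b) < y / sqrt 2 \<and> b \<in> {0<..<\<beta>}"
    using eventually_at_left_real[OF assms(1)] by eventually_elim auto
  then obtain b where b: "1 + sqrt (1 - b) < y / sqrt 2" "0 < b" "b < \<beta>"
    using eventually_happens'[of "at_left \<beta>"] trivial_limit_at_left_real by fastforce
  \<comment> \<open>The midpoint leaves an interval \<open>[b, c]\<close> that contains a grid point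
    once the mesh is small; \<open>\<delta>\<close> is the resulting margin in the exponent.\<close>
  define c where "c = (b + \<beta>) / 2"
  define \<delta> where "\<delta> = \<beta> - c"
  have c: "b < c" "c < \<beta>" "0 < \<delta>" using b by (auto simp: c_def \<delta>_def field_simps)
  have rhoc: "\<forall>\<^sub>F \<epsilon> in ?F. b + \<rho> \<epsilon> \<le> c"
  proof -
    have "\<forall>\<^sub>F \<epsilon> in ?F. \<rho> \<epsilon> < c - b" using assms(12) by (rule order_tendstoD) (use c in simp)
    then show ?thesis by eventually_elim simp
  qed
  \<comment> \<open>The 16 is the 8 of \<open>false_negative_exponent\<close> times the 2 in the
    bound \<open>\<kappa> * W \<le> 2 * (L^2 * W)\<close>.\<close>
  have dev: "\<forall>\<^sub>F \<epsilon> in ?F. 2 * (\<tau> \<epsilon> - 1) + 16 * ((L \<epsilon>)^2 * W \<epsilon>) < \<delta> / 2"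
  proof -
    have "((\<lambda>\<epsilon>. 2 * (\<tau> \<epsilon> - 1) + 16 * ((L \<epsilon>)^2 * W \<epsilon>)) \<longlongrightarrow> 2 * (1 - 1) + 16 * 0) ?F"
      by (intro tendsto_intros \<tau> L2W)
    then show ?thesis by (rule order_tendstoD) (use c in simp)
  qed
  \<comment> \<open>144 is 4 times the 36 of \<open>threshold_bounds\<close>, giving
    \<open>t * W \<le> 1/4\<close>.\<close>
  have L2W': "\<forall>\<^sub>F \<epsilon> in ?F. (L \<epsilon>)^2 * W \<epsilon> < 1/144"
    using L2W by (rule order_tendstoD) simp
  have eta2: "\<forall>\<^sub>F \<epsilon> in ?F. (\<Sum>u\<in>Ucal (k \<epsilon>) (d \<epsilon>). \<eta> \<epsilon> u) \<le> 2 * exp ((1 - \<beta>) * L \<epsilon>)"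
  proof -
    have "\<forall>\<^sub>F \<epsilon> in ?F. (\<Sum>u\<in>Ucal (k \<epsilon>) (d \<epsilon>). \<eta> \<epsilon> u) / real (d \<epsilon> choose k \<epsilon>) powr (1 - \<beta>) < 2"
      using assms(18) by (rule order_tendstoD) simp
    then show ?thesis using Llarge[of 1]
    proof eventually_elim
      case (elim \<epsilon>)
      have "d \<epsilon> choose k \<epsilon> \<noteq> 0" using elim(2) by (intro notI) (simp add: L_def)
      then have "real (d \<epsilon> choose k \<epsilon>) powr (1 - \<beta>) = exp ((1 - \<beta>) * L \<epsilon>)"
        by (simp add: powr_def L_def)
      then show ?case using elim(1) by (simp add: divide_less_eq)
    qed
  qed
  have "\<forall>\<^sub>F \<epsilon> in ?F. norm (risk \<sigma> \<epsilon> (d \<epsilon>) (k \<epsilon>) (\<rho> \<epsilon>) (ep \<epsilon>) (\<eta> \<epsilon>) (\<theta> \<epsilon>))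
      \<le> exp (- (ep \<epsilon> * L \<epsilon>) / 2 + 72 * ((L \<epsilon>)^2 * W \<epsilon>)) + 2 * exp (- (\<delta> / 2) * L \<epsilon>)"
    using pos klarge[of 1] Llarge[of 2] small M1 M_le ep1 ay rhoc dev L2W' eta2 assms(17) assms(19)
  proof eventually_elim
    case (elim \<epsilon>)
    note pos = elim(1) and k1 = elim(2) and L2 = elim(3) and sm = elim(4) and M1 = elim(5)
      and M_le = elim(6) and ep = elim(7) and ay = elim(8) and rhoc = elim(9) and dev = elim(10)
      and L2W = elim(11) and eta2 = elim(12) and eta01 = elim(13) and \<theta> = elim(14)
    have \<rho>: "0 < \<rho> \<epsilon>" and r: "0 < r \<epsilon>" using pos assms(9,11) by auto
    have L1: "1 \<le> L \<epsilon>" and L0: "0 < L \<epsilon>" using L2 by auto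
    obtain m where m: "m \<in> {1..Mk (\<rho> \<epsilon>)}" "b \<le> real m * \<rho> \<epsilon>" "real m * \<rho> \<epsilon> \<le> c"
      using grid_point[OF \<rho> b(2) rhoc] c assms(2) by auto
    define s where "s = sqrt (1 - real m * \<rho> \<epsilon>)"
    have s: "0 \<le> s" "s \<le> 1" "s^2 = 1 - real m * \<rho> \<epsilon>" "s \<le> sqrt (1 - b)"
      using m c b assms(2) by (auto simp: s_def)
    define t where "t = threshold (d \<epsilon>) (k \<epsilon>) (\<rho> \<epsilon>) (ep \<epsilon>)"
    \<comment> \<open>The gap between the mean \<open>(1 + s) * sqrt (2 * L)\<close> and the leading
      threshold \<open>sqrt (2 * L)\<close>.\<close>
    define \<kappa> where "\<kappa> = s * sqrt (2 * L \<epsilon>)"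
    have kappa0: "0 \<le> \<kappa>" using s L0 by (simp add: \<kappa>_def)
    have ep': "0 < ep \<epsilon>" "ep \<epsilon> \<le> 1" using ep by auto
    note tb = threshold_bounds[OF ep' L1 L_def M1 M_le[unfolded M_def], folded t_def]
    have M0: "0 \<le> M \<epsilon>" using M1 by (simp add: M_def)
    have ttau: "t = \<tau> \<epsilon> * sqrt (2 * L \<epsilon>)"
    proof -
      have "(2 + ep \<epsilon>) * (L \<epsilon> + M \<epsilon>) = (1 + ep \<epsilon> / 2) * (1 + M \<epsilon> / L \<epsilon>) * (2 * L \<epsilon>)"
        using L0 by (simp add: field_simps)
      then show ?thesis
        by (simp add: t_def threshold_def \<tau>_def real_sqrt_mult[symmetric] L_def[symmetric] M_def[symmetric])
    qed
    have tau1: "1 \<le> \<tau> \<epsilon>"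
    proof -
      have "1 * 1 \<le> (1 + ep \<epsilon> / 2) * (1 + M \<epsilon> / L \<epsilon>)" using ep' M0 L0 by (intro mult_mono) auto
      then show ?thesis by (simp add: \<tau>_def)
    qed
    have tW: "t * W \<epsilon> \<le> 1/4"
    proof -
      have "t ^ 1 \<le> t^4" using tb(1) by (intro power_increasing) auto
      then have "t * W \<epsilon> \<le> 36 * (L \<epsilon>)^2 * W \<epsilon>" using tb(3) W0 by (intro mult_right_mono) auto
      then show ?thesis using L2W by simp
    qed
    have kW: "\<kappa> * W \<epsilon> \<le> 2 * ((L \<epsilon>)^2 * W \<epsilon>)"
    proof -
      have "\<kappa> \<le> 1 * sqrt (2 * L \<epsilon>)" unfolding \<kappa>_def using s L0 by (intro mult_right_mono) auto
      also have "sqrt (2 * L \<epsilon>) \<le> 2 * (L \<epsilon>)^2"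
      proof (rule real_le_lsqrt)
        have "2 * L \<epsilon> \<le> L \<epsilon> * L \<epsilon>" using L2 by (intro mult_right_mono) auto
        also have "\<dots> \<le> (L \<epsilon> * L \<epsilon>) * (2 * L \<epsilon>)^2"
          using L1 one_le_power[of "2 * L \<epsilon>" 2] mult_left_mono[of 1 "(2 * L \<epsilon>)^2" "L \<epsilon> * L \<epsilon>"] by simp
        also have "\<dots> = (2 * (L \<epsilon>)^2)^2" by (simp add: power2_eq_square)
        finally show "2 * L \<epsilon> \<le> (2 * (L \<epsilon>)^2)^2" .
      qed (use L0 in auto)
      finally have "\<kappa> * W \<epsilon> \<le> 2 * (L \<epsilon>)^2 * W \<epsilon>" using W0 by (intro mult_right_mono) auto
      then show ?thesis by simp
    qed
    have a: "ereal ((1 + s) * sqrt (2 * L \<epsilon>)) < a_eps \<sigma> \<epsilon> (k \<epsilon>) (r \<epsilon>)"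
    proof -
      have "(1 + s) * sqrt (2 * L \<epsilon>) \<le> (y / sqrt 2) * sqrt (2 * L \<epsilon>)"
        using s b L0 by (intro mult_right_mono) auto
      also have "\<dots> = y * sqrt (L \<epsilon>)" by (simp add: real_sqrt_mult)
      finally have "ereal ((1 + s) * sqrt (2 * L \<epsilon>)) \<le> ereal y * ereal (sqrt (L \<epsilon>))" by simp
      also have "\<dots> < a_eps \<sigma> \<epsilon> (k \<epsilon>) (r \<epsilon>)"
        using ay L0 by (subst (asm) ereal_less_divide_pos) (auto simp: mult.commute)
      finally show ?thesis .
    qed
    have "\<bar>risk \<sigma> \<epsilon> (d \<epsilon>) (k \<epsilon>) (\<rho> \<epsilon>) (ep \<epsilon>) (\<eta> \<epsilon>) (\<theta> \<epsilon>)\<bar>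
      \<le> real (d \<epsilon> choose k \<epsilon>) * (real (Mk (\<rho> \<epsilon>)) * exp (- (t^2 / 2) + 2 * t^3 * W \<epsilon>))
        + (\<Sum>u\<in>Ucal (k \<epsilon>) (d \<epsilon>). \<eta> \<epsilon> u) *
          exp (\<kappa> * t + \<kappa>^2 / 2 - \<kappa> * ((1 + s) * sqrt (2 * L \<epsilon>)) / (1 + 2 * \<kappa> * W \<epsilon>))"
      unfolding L_def W_def t_def s_def
      by (rule risk_bound[OF assms(3) _ k1 _ _ \<rho> m(1) _ _ eta01 \<theta> r _ kappa0])
        (use pos L0 sm tb(1) tW a in \<open>simp_all add: L_def W_def t_def s_def\<close>)
    also have "\<dots> \<le> exp (- (ep \<epsilon> * L \<epsilon>) / 2 + 72 * ((L \<epsilon>)^2 * W \<epsilon>)) + 2 * exp (- (\<delta> / 2) * L \<epsilon>)"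
    proof (rule add_mono)
      show "real (d \<epsilon> choose k \<epsilon>) * (real (Mk (\<rho> \<epsilon>)) * exp (- (t^2 / 2) + 2 * t^3 * W \<epsilon>))
        \<le> exp (- (ep \<epsilon> * L \<epsilon>) / 2 + 72 * ((L \<epsilon>)^2 * W \<epsilon>))"
        unfolding t_def by (rule false_positive_total[OF ep' L1 L_def M1 M_le[unfolded M_def] W0])
      let ?e = "\<kappa> * t + \<kappa>^2 / 2 - \<kappa> * ((1 + s) * sqrt (2 * L \<epsilon>)) / (1 + 2 * \<kappa> * W \<epsilon>)"
      have "?e \<le> L \<epsilon> * (2 * (\<tau> \<epsilon> - 1) - s^2 + 8 * (\<kappa> * W \<epsilon>))"
        unfolding ttau \<kappa>_def by (rule false_negative_exponent[OF s(1,2) L0 W0 tau1])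
      also have "\<dots> \<le> L \<epsilon> * (- (1 - \<beta>) - \<delta> / 2)"
      proof (rule mult_left_mono)
        \<comment> \<open>\<open>s^2 \<ge> 1 - c = 1 - \<beta> + \<delta>\<close>; half of the
          margin pays for the deviations in \<open>dev\<close>, the other half is the final
          decay.\<close>
        have "c = \<beta> - \<delta>" by (simp add: \<delta>_def)
        then show "2 * (\<tau> \<epsilon> - 1) - s^2 + 8 * (\<kappa> * W \<epsilon>) \<le> - (1 - \<beta>) - \<delta> / 2"
          using dev kW s(3) m(3) by linarith
      qed (use L0 in simp)
      finally have e: "?e \<le> L \<epsilon> * (- (1 - \<beta>) - \<delta> / 2)" .
      have "(\<Sum>u\<in>Ucal (k \<epsilon>) (d \<epsilon>). \<eta> \<epsilon> u) * exp ?e \<le> 2 * exp ((1 - \<beta>) * L \<epsilon>) * exp (L \<epsilon> * (- (1 - \<beta>) - \<delta> / 2))"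
        using eta2 e by (intro mult_mono) auto
      also have "\<dots> = 2 * exp (- (\<delta> / 2) * L \<epsilon>)"
        unfolding mult.assoc exp_add[symmetric] by (simp add: algebra_simps)
      finally show "(\<Sum>u\<in>Ucal (k \<epsilon>) (d \<epsilon>). \<eta> \<epsilon> u) * exp ?e \<le> 2 * exp (- (\<delta> / 2) * L \<epsilon>)" .
    qed
    finally show ?case by simp
  qed
  moreover have "((\<lambda>\<epsilon>. exp (- (ep \<epsilon> * L \<epsilon>) / 2 + 72 * ((L \<epsilon>)^2 * W \<epsilon>)) + 2 * exp (- (\<delta> / 2) * L \<epsilon>)) \<longlongrightarrow> 0) ?F"
  proof -
    \<comment> \<open>False positives vanish because \<open>ep\<close> times the log cardinality
      diverges; the false negative term needs only \<open>L\<close> to diverge.\<close>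
    have "filterlim (\<lambda>\<epsilon>. (1/2) * (ep \<epsilon> * L \<epsilon>)) at_top ?F"
      unfolding L_def by (rule filterlim_tendsto_pos_mult_at_top[OF tendsto_const _ assms(16)]) simp
    then have "filterlim (\<lambda>\<epsilon>. - ((1/2) * (ep \<epsilon> * L \<epsilon>))) at_bot ?F"
      by (simp add: filterlim_uminus_at_top)
    from filterlim_compose[OF exp_at_bot this]
    have "((\<lambda>\<epsilon>. exp (- ((1/2) * (ep \<epsilon> * L \<epsilon>))) * exp (72 * ((L \<epsilon>)^2 * W \<epsilon>))) \<longlongrightarrow> 0 * exp (72 * 0)) ?F"
      by (intro tendsto_intros L2W)
    then have 1: "((\<lambda>\<epsilon>. exp (- (ep \<epsilon> * L \<epsilon>) / 2 + 72 * ((L \<epsilon>)^2 * W \<epsilon>))) \<longlongrightarrow> 0) ?F"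
      by (simp add: exp_add[symmetric])
    have "filterlim (\<lambda>\<epsilon>. (\<delta> / 2) * L \<epsilon>) at_top ?F"
      by (rule filterlim_tendsto_pos_mult_at_top[OF tendsto_const _ Ltop]) (use c in simp)
    then have "filterlim (\<lambda>\<epsilon>. - (\<delta> / 2) * L \<epsilon>) at_bot ?F"
      by (simp add: filterlim_uminus_at_top)
    from filterlim_compose[OF exp_at_bot this]
    have "((\<lambda>\<epsilon>. 2 * exp (- (\<delta> / 2) * L \<epsilon>)) \<longlongrightarrow> 0) ?F" by (rule tendsto_mult_right_zero)
    from tendsto_add[OF 1 this] show ?thesis by simp
  qed
  ultimately show ?thesis by (rule Lim_null_comparison)
qed

end
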